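(* Let $r\ge 1$. Let $X$ and $Y$ be connected $C^r$-manifolds (possibly with boundary) of equal dimensions, with $X$ compact. Let $f\colon X\to Y$ be a $C^r$-mapping whose differential $\mathrm{d}f$ is nondegenerate on $X$ (that is, $\operatorname{rank}(\mathrm{d}f)=\dim X$ at every point of $X$), and such that $f(\partial X)\subseteq\partial Y$. Then $f$ is a smooth covering.
   Context: An $n$-dimensional topological manifold is a Hausdorff space having a countable cover by open sets each homeomorphic either to $\mathbb{R}^n$ or to $\mathbb{R}^n_+=\{(x_1,\ldots,x_n): x_i\in\mathbb{R},\ x_1\ge 0\}$; its boundary $\partial X$ is the set of points having no neighborhood homeomorphic to $\mathbb{R}^n$ (it may be empty). A chart is a homeomorphism of an open domain $U\subset X$ to $\mathbb{R}^n$ or $\mathbb{R}^n_+$; a $C^r$-structure is a cover of $X$ by charts whose transition maps and their inverses are pairwise $C^r$-smooth, two structures being equivalent if their union is also a $C^r$-structure. A $C^r$-manifold is a topological manifold with an equivalence class of $C^r$-structures. A $C^r$-mapping is a continuous mapping that is $C^r$-smooth in charts. A continuous mapping $f\colon X\to Y$ is a covering if every point $y\in Y$ has a neighborhood $V$ such that $f$ maps every connected component of $f^{-1}(V)$ homeomorphically onto $V$; "smooth covering" has its standard meaning: $f$ is a $C^r$-mapping and these homeomorphisms onto $V$ are $C^r$-diffeomorphisms (bijective $C^r$-mappings with $C^r$ inverse). *)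

theory Defs
  imports "HOL-Analysis.Analysis" "HOL-Library.Extended_Nat"
begin

text \<open>
  Euclidean space of dimension \<open>n \<ge> 1\<close> is a type \<open>'m\<close> of class
  \<^class>\<open>euclidean_space\<close> with \<open>n = DIM('m)\<close>. The smoothness class \<open>r\<close> is an
  \<^typ>\<open>enat\<close>, so that \<open>r = \<infinity>\<close> is included.
\<close>

text \<open>The arbitrary but fixed basis vector plays the role of the first coordinate direction.\<close>

definition first_axis :: "'m::euclidean_space" where
  "first_axis = (SOME b. b \<in> Basis)"

definition half_space :: "'m::euclidean_space set" where
  "half_space = {x. 0 \<le> x \<bullet> first_axis}"

text \<open>Meant for open \<open>V\<close> only, since derivatives are taken in the whole space.\<close>

primrec times_cont_diff_on ::
  "nat \<Rightarrow> 'm::euclidean_space set \<Rightarrow> ('m \<Rightarrow> 'n::euclidean_space) \<Rightarrow> bool"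
where
  "times_cont_diff_on 0 V g \<longleftrightarrow> continuous_on V g"
| "times_cont_diff_on (Suc k) V g \<longleftrightarrow>
     (\<forall>x\<in>V. g differentiable (at x)) \<and>
     (\<forall>v. times_cont_diff_on k V (\<lambda>x. frechet_derivative g (at x) v))"

text \<open>
  On an open set the next predicate is the usual \<open>C\<^sup>r\<close>-smoothness. On relatively open subsets of
  the half-space it is the usual convention for manifolds with boundary: near each point the map
  is the restriction of a \<open>C\<^sup>r\<close>-map defined on an open set of the whole space.
\<close>

definition Cr_smooth_on ::
  "enat \<Rightarrow> 'm::euclidean_space set \<Rightarrow> ('m \<Rightarrow> 'n::euclidean_space) \<Rightarrow> bool"
where
  "Cr_smooth_on r W g \<longleftrightarrow>
     (\<forall>x\<in>W. \<exists>V h. open V \<and> x \<in> V \<and> (\<forall>k. enat k \<le> r \<longrightarrow> times_cont_diff_on k V h) \<and>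
                  (\<forall>y\<in>V \<inter> W. h y = g y))"


definition topological_manifold :: "'m::euclidean_space itself \<Rightarrow> 'a topology \<Rightarrow> bool" where
  "topological_manifold _ X \<longleftrightarrow>
     Hausdorff_space X \<and>
     (\<exists>\<U>. countable \<U> \<and> \<Union>\<U> = topspace X \<and>
        (\<forall>U\<in>\<U>. openin X U \<and>
           (subtopology X U homeomorphic_space (euclidean :: 'm topology) \<or>
            subtopology X U homeomorphic_space top_of_set (half_space :: 'm set))))"

definition manifold_boundary :: "'m::euclidean_space itself \<Rightarrow> 'a topology \<Rightarrow> 'a set" where
  "manifold_boundary _ X =
     {x \<in> topspace X. \<not> (\<exists>U. openin X U \<and> x \<in> U \<and>
                             subtopology X U homeomorphic_space (euclidean :: 'm topology))}"

text \<open>A chart is a domain together with a map; values of the map outside the domain are irrelevant.\<close>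

type_synonym ('a, 'm) chart = "'a set \<times> ('a \<Rightarrow> 'm)"

definition is_chart :: "'a topology \<Rightarrow> ('a, 'm::euclidean_space) chart \<Rightarrow> bool" where
  "is_chart X c \<longleftrightarrow> (case c of (U, \<phi>) \<Rightarrow>
     openin X U \<and>
     (homeomorphic_map (subtopology X U) euclidean \<phi> \<or>
      homeomorphic_map (subtopology X U) (top_of_set half_space) \<phi>))"

definition Cr_structure ::
  "enat \<Rightarrow> 'a topology \<Rightarrow> ('a, 'm::euclidean_space) chart set \<Rightarrow> bool"
where
  "Cr_structure r X \<A> \<longleftrightarrow>
     (\<forall>c\<in>\<A>. is_chart X c) \<and>
     (\<Union>c\<in>\<A>. fst c) = topspace X \<and>
     (\<forall>(U, \<phi>)\<in>\<A>. \<forall>(V, \<psi>)\<in>\<A>. Cr_smooth_on r (\<phi> ` (U \<inter> V)) (\<psi> \<circ> inv_into U \<phi>))"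

definition Cr_equivalence ::
  "enat \<Rightarrow> 'a topology \<Rightarrow> (('a, 'm::euclidean_space) chart set \<times> ('a, 'm) chart set) set"
where
  "Cr_equivalence r X =
     {(\<A>, \<B>). Cr_structure r X \<A> \<and> Cr_structure r X \<B> \<and> Cr_structure r X (\<A> \<union> \<B>)}"

text \<open>
  In \<open>Cr_manifold r X S\<close>, \<open>S\<close> is an equivalence class of structures; the charts of the
  manifold are the elements of \<open>\<Union>S\<close>.
\<close>

definition Cr_manifold ::
  "enat \<Rightarrow> 'a topology \<Rightarrow> ('a, 'm::euclidean_space) chart set set \<Rightarrow> bool"
where
  "Cr_manifold r X S \<longleftrightarrow>
     topological_manifold TYPE('m) X \<and> S \<in> {\<A>. Cr_structure r X \<A>} // Cr_equivalence r X"


text \<open>The coordinate representation of \<open>f\<close> in a pair of charts, and the domain where it is meaningful.\<close>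

definition coord_rep ::
  "('a, 'm) chart \<Rightarrow> ('b, 'm) chart \<Rightarrow> ('a \<Rightarrow> 'b) \<Rightarrow> 'm \<Rightarrow> 'm"
where
  "coord_rep c d f = snd d \<circ> f \<circ> inv_into (fst c) (snd c)"

definition coord_dom ::
  "('a, 'm) chart \<Rightarrow> ('b, 'm) chart \<Rightarrow> ('a \<Rightarrow> 'b) \<Rightarrow> 'a set \<Rightarrow> 'm set"
where
  "coord_dom c d f C = snd c ` {x \<in> fst c \<inter> C. f x \<in> fst d}"

text \<open>\<open>C\<close> and \<open>D\<close> are meant to be open; they carry the structure induced from the ambient manifold.\<close>

definition Cr_mapping_on ::
  "enat \<Rightarrow> 'a topology \<Rightarrow> ('a, 'm::euclidean_space) chart set set \<Rightarrow> 'a set \<Rightarrow>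
   'b topology \<Rightarrow> ('b, 'm) chart set set \<Rightarrow> 'b set \<Rightarrow> ('a \<Rightarrow> 'b) \<Rightarrow> bool"
where
  "Cr_mapping_on r X S C Y T D f \<longleftrightarrow>
     continuous_map (subtopology X C) (subtopology Y D) f \<and>
     (\<forall>c\<in>\<Union>S. \<forall>d\<in>\<Union>T. Cr_smooth_on r (coord_dom c d f C) (coord_rep c d f))"

definition Cr_mapping ::
  "enat \<Rightarrow> 'a topology \<Rightarrow> ('a, 'm::euclidean_space) chart set set \<Rightarrow>
   'b topology \<Rightarrow> ('b, 'm) chart set set \<Rightarrow> ('a \<Rightarrow> 'b) \<Rightarrow> bool"
where
  "Cr_mapping r X S Y T f \<longleftrightarrow> Cr_mapping_on r X S (topspace X) Y T (topspace Y) f"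

definition Cr_diffeomorphism_on ::
  "enat \<Rightarrow> 'a topology \<Rightarrow> ('a, 'm::euclidean_space) chart set set \<Rightarrow> 'a set \<Rightarrow>
   'b topology \<Rightarrow> ('b, 'm) chart set set \<Rightarrow> 'b set \<Rightarrow> ('a \<Rightarrow> 'b) \<Rightarrow> bool"
where
  "Cr_diffeomorphism_on r X S C Y T D f \<longleftrightarrow>
     openin X C \<and> openin Y D \<and> bij_betw f C D \<and>
     Cr_mapping_on r X S C Y T D f \<and> Cr_mapping_on r Y T D X S C (inv_into C f)"

text \<open>
  The differential at \<open>x\<close> is read off in charts. At a point of the boundary the derivative is
  taken within the half-space, where it is still unique; it is the derivative of any
  \<open>C\<^sup>r\<close>-extension.
\<close>

definition nondegenerate_differential ::
  "'a topology \<Rightarrow> ('a, 'm::euclidean_space) chart set set \<Rightarrow> ('b, 'm) chart set set \<Rightarrow>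
   ('a \<Rightarrow> 'b) \<Rightarrow> bool"
where
  "nondegenerate_differential X S T f \<longleftrightarrow>
     (\<forall>x\<in>topspace X. \<forall>c\<in>\<Union>S. \<forall>d\<in>\<Union>T. x \<in> fst c \<longrightarrow> f x \<in> fst d \<longrightarrow>
        (\<exists>L. (coord_rep c d f has_derivative L)
                (at (snd c x) within coord_dom c d f (topspace X)) \<and>
             dim (range L) = DIM('m)))"


definition sheets :: "'a topology \<Rightarrow> ('a \<Rightarrow> 'b) \<Rightarrow> 'b set \<Rightarrow> 'a set set" where
  "sheets X f V = connected_components_of (subtopology X {x \<in> topspace X. f x \<in> V})"

definition covering :: "'a topology \<Rightarrow> 'b topology \<Rightarrow> ('a \<Rightarrow> 'b) \<Rightarrow> bool" where
  "covering X Y f \<longleftrightarrow>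
     continuous_map X Y f \<and>
     (\<forall>y\<in>topspace Y. \<exists>V. openin Y V \<and> y \<in> V \<and>
        (\<forall>C\<in>sheets X f V. homeomorphic_map (subtopology X C) (subtopology Y V) f))"

definition smooth_covering ::
  "enat \<Rightarrow> 'a topology \<Rightarrow> ('a, 'm::euclidean_space) chart set set \<Rightarrow>
   'b topology \<Rightarrow> ('b, 'm) chart set set \<Rightarrow> ('a \<Rightarrow> 'b) \<Rightarrow> bool"
where
  "smooth_covering r X S Y T f \<longleftrightarrow>
     Cr_mapping r X S Y T f \<and>
     (\<forall>y\<in>topspace Y. \<exists>V. openin Y V \<and> y \<in> V \<and>
        (\<forall>C\<in>sheets X f V. homeomorphic_map (subtopology X C) (subtopology Y V) f \<and>
                            Cr_diffeomorphism_on r X S C Y T V f))"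

lemma smooth_covering_imp_covering:
  "smooth_covering r X S Y T f \<Longrightarrow> covering X Y f"
  unfolding smooth_covering_def covering_def Cr_mapping_def Cr_mapping_on_def
  by (simp, meson)

end

theory Submission
  imports Defs
begin

text \<open>
  The map \<open>f\<close> is a local \<open>C\<^sup>r\<close>-diffeomorphism, and a local homeomorphism from a compact Hausdorff space
  to a locally connected Hausdorff space is a covering.

  At an interior point the first claim is the inverse function theorem. To treat interior and
  boundary points alike, both model spaces \<open>\<real>\<^sup>n\<close> and \<open>\<real>\<^sup>n\<^sub>+\<close> are regarded as closed convex sets \<open>M\<close> with
  nonempty interior. In charts, \<open>f\<close> extends near the image \<open>p\<close> of a given point to a \<open>C\<^sup>r\<close>-map \<open>h\<close>
  on an open set of \<open>\<real>\<^sup>n\<close>, with invertible derivative at \<open>p\<close>; it maps \<open>M\<close> into the model \<open>N\<close> of the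
  target chart and, since \<open>f\<close> preserves boundaries, the frontier of \<open>M\<close> into that of \<open>N\<close>. Let \<open>H\<close> be
  the local inverse of \<open>h\<close> on a small ball \<open>Q\<close> around \<open>h p\<close>. The convex set \<open>Q \<inter> interior N\<close> is
  connected, so its image under \<open>H\<close>, which misses the frontier of \<open>M\<close>, lies on one side of it; it
  meets the interior of \<open>M\<close>, hence lies in \<open>M\<close>. Taking closures, \<open>H\<close> maps \<open>Q \<inter> N\<close> into \<open>M\<close>, and
  thus \<open>h\<close> restricts to a bijection of a neighbourhood of \<open>p\<close> in \<open>M\<close> onto \<open>Q \<inter> N\<close>
  (\<open>local_diffeomorphism_of_convex_bodies\<close>). That topological boundary points are exactly
  those that charts send to the frontier is invariance of domain (\<open>boundary_in_chart\<close>). The inverse \<open>H\<close>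
  is of class \<open>C\<^sup>r\<close> because inversion of linear maps preserves smoothness
  (\<open>times_cont_diff_on_inverse\<close>).

  For the second claim, a point \<open>y\<close> has finitely many preimages, with pairwise disjoint neighbourhoods
  on which \<open>f\<close> is injective and open. The rest of the domain has a closed image missing \<open>y\<close>, so a small
  connected neighbourhood \<open>V\<close> of \<open>y\<close> is evenly covered by these neighbourhoods, and the parts of
  them above \<open>V\<close>, being connected, open and disjoint, are the components of the preimage of \<open>V\<close>
  (\<open>local_homeomorphism_evenly_covers\<close>).
\<close>

section \<open>Calculus of \<open>C\<^sup>k\<close>-maps between Euclidean spaces\<close>

lemma has_derivative_frechet:
  assumes "times_cont_diff_on (Suc k) V g" and "x \<in> V"
  shows "(g has_derivative frechet_derivative g (at x)) (at x)"
  using assms frechet_derivative_works[of g "at x"] by auto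

lemma times_cont_diff_on_cong:
  fixes g h :: "'m::euclidean_space \<Rightarrow> 'n::euclidean_space"
  assumes "open V" and "times_cont_diff_on k V g" and "\<And>x. x \<in> V \<Longrightarrow> g x = h x"
  shows "times_cont_diff_on k V h"
  using assms(2,3)
proof (induction k arbitrary: g h)
  case 0
  then show ?case by (simp cong: continuous_on_cong)
next
  case (Suc k)
  have deriv: "(h has_derivative frechet_derivative g (at x)) (at x)" if "x \<in> V" for x
    by (rule has_derivative_transform_within_open[OF has_derivative_frechet[OF Suc.prems(1) that]
          \<open>open V\<close> that Suc.prems(2)])
  have "times_cont_diff_on k V (\<lambda>x. frechet_derivative h (at x) v)" for v
  proof (rule Suc.IH)
    show "times_cont_diff_on k V (\<lambda>x. frechet_derivative g (at x) v)"
      using Suc.prems(1) by simp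
    show "frechet_derivative g (at x) v = frechet_derivative h (at x) v" if "x \<in> V" for x
      using frechet_derivative_at[OF deriv[OF that]] by simp
  qed
  then show ?case
    using deriv by (auto simp: differentiable_def)
qed

lemma times_cont_diff_on_derivI:
  fixes g :: "'m::euclidean_space \<Rightarrow> 'n::euclidean_space"
  assumes "\<And>x. x \<in> V \<Longrightarrow> (g has_derivative g' x) (at x)"
    and "\<And>v. times_cont_diff_on k V (\<lambda>x. g' x v)" and "open V"
  shows "times_cont_diff_on (Suc k) V g"
proof -
  have "times_cont_diff_on k V (\<lambda>x. frechet_derivative g (at x) v)" for v
    by (rule times_cont_diff_on_cong[OF \<open>open V\<close> assms(2)[of v]])
       (use frechet_derivative_at[OF assms(1)] in metis)
  then show ?thesis
    using assms(1) by (auto simp: differentiable_def)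
qed

lemma times_cont_diff_on_SucD:
  assumes "times_cont_diff_on (Suc k) V g"
  shows "times_cont_diff_on k V g"
  using assms
proof (induction k arbitrary: g)
  case 0
  then show ?case
    by (auto intro!: continuous_at_imp_continuous_on differentiable_imp_continuous_within)
next
  case (Suc k)
  then show ?case by (auto simp del: times_cont_diff_on.simps(1))
qed

lemma times_cont_diff_on_mono:
  assumes "times_cont_diff_on k V g" and "j \<le> k"
  shows "times_cont_diff_on j V g"
  using assms(2,1) by (induction rule: dec_induct) (use times_cont_diff_on_SucD in blast)+

lemma times_cont_diff_on_subset:
  assumes "times_cont_diff_on k V g" and "U \<subseteq> V"
  shows "times_cont_diff_on k U g"
  using assms(1)
  by (induction k arbitrary: g) (use assms(2) in \<open>auto intro: continuous_on_subset\<close>)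

lemma times_cont_diff_on_frechet:
  assumes "times_cont_diff_on (Suc k) V g"
  shows "times_cont_diff_on k V (\<lambda>x. frechet_derivative g (at x) v)"
  using assms by simp

lemma times_cont_diff_on_const:
  assumes "open V"
  shows "times_cont_diff_on k V (\<lambda>x. c)"
proof (induction k arbitrary: c)
  case (Suc k)
  then show ?case
    by (intro times_cont_diff_on_derivI[where g' = "\<lambda>_ _. 0"]) (use assms in auto)
qed simp

lemma times_cont_diff_on_bounded_linear:
  assumes "open V" and "bounded_linear F" and "times_cont_diff_on k V g"
  shows "times_cont_diff_on k V (\<lambda>x. F (g x))"
  using assms(3)
proof (induction k arbitrary: g)
  case 0
  then show ?case by (auto intro: bounded_linear.continuous_on[OF assms(2)])
next
  case (Suc k)
  show ?case
    by (rule times_cont_diff_on_derivI[OF bounded_linear.has_derivative[OF assms(2)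
          has_derivative_frechet[OF Suc.prems]]
          Suc.IH[OF times_cont_diff_on_frechet[OF Suc.prems]] \<open>open V\<close>])
qed

lemma times_cont_diff_on_add:
  assumes "open V" and "times_cont_diff_on k V f" and "times_cont_diff_on k V g"
  shows "times_cont_diff_on k V (\<lambda>x. f x + g x)"
  using assms(2,3)
proof (induction k arbitrary: f g)
  case 0
  then show ?case by (auto intro: continuous_on_add)
next
  case (Suc k)
  show ?case
    by (rule times_cont_diff_on_derivI[OF has_derivative_add[OF has_derivative_frechet[OF Suc.prems(1)]
          has_derivative_frechet[OF Suc.prems(2)]]
          Suc.IH[OF Suc.prems[THEN times_cont_diff_on_frechet]] \<open>open V\<close>])
qed

lemma times_cont_diff_on_sum:
  assumes "open V" and "\<And>i. i \<in> I \<Longrightarrow> times_cont_diff_on k V (f i)"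
  shows "times_cont_diff_on k V (\<lambda>x. \<Sum>i\<in>I. f i x)"
  using assms(2)
  by (induction I rule: infinite_finite_induct)
     (simp_all add: times_cont_diff_on_const times_cont_diff_on_add assms(1))

lemma times_cont_diff_on_scaleR:
  fixes s :: "'m::euclidean_space \<Rightarrow> real" and g :: "'m \<Rightarrow> 'n::euclidean_space"
  assumes "open V" and "times_cont_diff_on k V s" and "times_cont_diff_on k V g"
  shows "times_cont_diff_on k V (\<lambda>x. s x *\<^sub>R g x)"
  using assms(2,3)
proof (induction k arbitrary: s g)
  case 0
  then show ?case by (auto intro: continuous_on_scaleR)
next
  case (Suc k)
  show ?case
  proof (rule times_cont_diff_on_derivI[OF has_derivative_scaleR[OF
          has_derivative_frechet[OF Suc.prems(1)] has_derivative_frechet[OF Suc.prems(2)]] _ \<open>open V\<close>])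
    show "times_cont_diff_on k V
            (\<lambda>x. s x *\<^sub>R frechet_derivative g (at x) v + frechet_derivative s (at x) v *\<^sub>R g x)" for v
      by (intro times_cont_diff_on_add[OF \<open>open V\<close>]
          Suc.IH[OF Suc.prems(1)[THEN times_cont_diff_on_SucD] Suc.prems(2)[THEN times_cont_diff_on_frechet]]
          Suc.IH[OF Suc.prems(1)[THEN times_cont_diff_on_frechet] Suc.prems(2)[THEN times_cont_diff_on_SucD]])
  qed
qed

lemma linear_basis_expansion:
  assumes "linear F"
  shows "F z = (\<Sum>b\<in>Basis. (z \<bullet> b) *\<^sub>R F b)"
  by (metis (no_types, lifting) assms euclidean_representation linear_cmul linear_sum sum.cong)

text \<open>
  The product rule for a smoothly varying linear map applied to a smoothly varying vector. Expanding
  the vector in the basis reduces it to sums of scalar multiples, so that smoothness of a family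
  of linear maps only ever has to be tested on fixed vectors.
\<close>

lemma times_cont_diff_on_apply_linear:
  fixes F :: "'m::euclidean_space \<Rightarrow> 'k::euclidean_space \<Rightarrow> 'n::euclidean_space"
  assumes "open V" and "\<And>x. x \<in> V \<Longrightarrow> linear (F x)"
    and "\<And>b. b \<in> Basis \<Longrightarrow> times_cont_diff_on k V (\<lambda>x. F x b)" and "times_cont_diff_on k V w"
  shows "times_cont_diff_on k V (\<lambda>x. F x (w x))"
proof (rule times_cont_diff_on_cong[OF \<open>open V\<close>])
  show "times_cont_diff_on k V (\<lambda>x. \<Sum>b\<in>Basis. (w x \<bullet> b) *\<^sub>R F x b)"
    by (rule times_cont_diff_on_sum[OF \<open>open V\<close>], rule times_cont_diff_on_scaleR[OF \<open>open V\<close>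
          times_cont_diff_on_bounded_linear[OF \<open>open V\<close> bounded_linear_inner_left assms(4)] assms(3)])
  show "(\<Sum>b\<in>Basis. (w x \<bullet> b) *\<^sub>R F x b) = F x (w x)" if "x \<in> V" for x
    by (rule linear_basis_expansion[OF assms(2)[OF that], symmetric])
qed

lemma times_cont_diff_on_compose:
  assumes "open U" and "open V" and "times_cont_diff_on k U g" and "times_cont_diff_on k V f"
    and "f ` V \<subseteq> U"
  shows "times_cont_diff_on k V (\<lambda>x. g (f x))"
  using assms(3,4)
proof (induction k arbitrary: g)
  case 0
  then show ?case
    using assms(5) by (auto intro: continuous_on_compose2)
next
  case (Suc k)
  note Dg = has_derivative_frechet[OF Suc.prems(1)] and Df = has_derivative_frechet[OF Suc.prems(2)]
  have fU: "f x \<in> U" if "x \<in> V" for x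
    using that assms(5) by auto
  show ?case
  proof (rule times_cont_diff_on_derivI[OF _ _ \<open>open V\<close>])
    show "((\<lambda>x. g (f x)) has_derivative
            (\<lambda>v. frechet_derivative g (at (f x)) (frechet_derivative f (at x) v))) (at x)"
      if "x \<in> V" for x
      using has_derivative_compose[OF Df Dg] that fU by blast
    show "times_cont_diff_on k V
            (\<lambda>x. frechet_derivative g (at (f x)) (frechet_derivative f (at x) v))" for v
    proof (rule times_cont_diff_on_apply_linear[OF \<open>open V\<close>,
          where F = "\<lambda>x. frechet_derivative g (at (f x))" and w = "\<lambda>x. frechet_derivative f (at x) v"])
      show "linear (frechet_derivative g (at (f x)))" if "x \<in> V" for x
        using Dg[OF fU[OF that]] by (rule has_derivative_linear)
      show "times_cont_diff_on k V (\<lambda>x. frechet_derivative g (at (f x)) b)" for b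
        by (rule Suc.IH) (use Suc.prems times_cont_diff_on_frechet times_cont_diff_on_SucD in blast)+
    qed (rule times_cont_diff_on_frechet[OF Suc.prems(2)])
  qed
qed

text \<open>
  A product is differentiable at a zero of one factor as soon as the other factor is merely continuous
  there. This is what makes the inverse of a differentiable family of linear maps differentiable
  once it is known to be continuous.
\<close>

lemma has_derivative_zero_scaleR:
  fixes s :: "'m::real_normed_vector \<Rightarrow> real" and c :: "'m \<Rightarrow> 'n::real_normed_vector"
  assumes s: "(s has_derivative s') (at x)" and "s x = 0" and "isCont c x"
  shows "((\<lambda>y. s y *\<^sub>R c y) has_derivative (\<lambda>v. s' v *\<^sub>R c x)) (at x)"
proof -
  have bl: "bounded_linear s'"
    using s by (rule has_derivative_bounded_linear)
  then obtain K where K: "\<And>v. norm (s' v) \<le> norm v * K"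
    using bounded_linear.bounded by blast
  have lim: "((\<lambda>y. norm (s y - s x - s' (y - x)) / norm (y - x)) \<longlongrightarrow> 0) (at x)"
    using s unfolding has_derivative_iff_norm by blast
  have "((\<lambda>y. norm (s y - s x - s' (y - x)) / norm (y - x) * norm (c y) + K * norm (c y - c x))
          \<longlongrightarrow> 0 * norm (c x) + K * norm (c x - c x)) (at x)"
    using \<open>isCont c x\<close> by (intro tendsto_intros lim) (auto simp: isCont_def)
  then have lim2: "((\<lambda>y. norm (s y - s x - s' (y - x)) / norm (y - x) * norm (c y) + K * norm (c y - c x))
          \<longlongrightarrow> 0) (at x)" by simp
  have "((\<lambda>y. norm (s y *\<^sub>R c y - s x *\<^sub>R c x - s' (y - x) *\<^sub>R c x) / norm (y - x)) \<longlongrightarrow> 0) (at x)"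
  proof (rule Lim_null_comparison[OF _ lim2], rule eventually_at_filter[THEN iffD2], rule always_eventually, intro allI impI)
    fix y assume "y \<noteq> x"
    have "norm (s y *\<^sub>R c y - s x *\<^sub>R c x - s' (y - x) *\<^sub>R c x)
        = norm ((s y - s x - s' (y - x)) *\<^sub>R c y + s' (y - x) *\<^sub>R (c y - c x))"
      by (simp add: \<open>s x = 0\<close> algebra_simps)
    also have "\<dots> \<le> norm (s y - s x - s' (y - x)) * norm (c y) + norm (y - x) * K * norm (c y - c x)"
      by (rule order_trans[OF norm_triangle_ineq]) (use K in \<open>auto intro!: add_mono mult_right_mono\<close>)
    finally show "norm (norm (s y *\<^sub>R c y - s x *\<^sub>R c x - s' (y - x) *\<^sub>R c x) / norm (y - x))
        \<le> norm (s y - s x - s' (y - x)) / norm (y - x) * norm (c y) + K * norm (c y - c x)"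
      using \<open>y \<noteq> x\<close> by (simp add: field_simps)
  qed
  then show ?thesis
    unfolding has_derivative_iff_norm
    using bounded_linear_scaleR_const[OF bl] by simp
qed

text \<open>
  An injective linear map is bounded below, and nearby members of a continuous family inherit half
  the bound. It controls the distance of the solutions of \<open>A y z = v\<close> and \<open>A y\<^sub>0 z = v\<close> by the error that
  the second leaves in the first equation.
\<close>

lemma continuous_on_inverse_operators:
  fixes A B :: "'m::metric_space \<Rightarrow> 'n::euclidean_space \<Rightarrow> 'n"
  assumes lin: "\<And>y. y \<in> W \<Longrightarrow> linear (A y)"
    and BA: "\<And>y z. y \<in> W \<Longrightarrow> B y (A y z) = z"
    and AB: "\<And>y z. y \<in> W \<Longrightarrow> A y (B y z) = z"
    and cont: "\<And>z. continuous_on W (\<lambda>y. A y z)"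
  shows "continuous_on W (\<lambda>y. B y v)"
  unfolding continuous_on_def
proof
  fix y0 assume y0: "y0 \<in> W"
  \<comment> \<open>The claimed limit; its defect in the equation at \<open>y\<close> is \<open>v - A y w\<close>.\<close>
  define w where "w = B y0 v"
  have "inj (A y0)"
    using BA[OF y0] by (rule inj_on_inverseI)
  then obtain m where "m > 0" and m: "\<And>z. m * norm z \<le> norm (A y0 z)"
    using linear_inj_bounded_below_pos[OF lin[OF y0]] by (metis)
  let ?\<delta> = "\<lambda>y. \<Sum>b\<in>Basis. norm (A y b - A y0 b)"
  have lim: "((\<lambda>y. A y z) \<longlongrightarrow> A y0 z) (at y0 within W)" for z
    using cont y0 by (auto simp: continuous_on_def)
  have "(?\<delta> \<longlongrightarrow> (\<Sum>b\<in>(Basis::'n set). norm (A y0 b - A y0 b))) (at y0 within W)"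
    by (intro tendsto_intros lim)
  then have "(?\<delta> \<longlongrightarrow> 0) (at y0 within W)" by simp
  then have ev: "eventually (\<lambda>y. ?\<delta> y < m / 2) (at y0 within W)"
    using \<open>m > 0\<close> by (intro order_tendstoD) auto
  have bound: "norm (B y v - w) \<le> 2 / m * norm (v - A y w)" if "y \<in> W" and small: "?\<delta> y < m / 2" for y
  proof -
    let ?z = "B y v - w"
    have "A y ?z - A y0 ?z = (\<Sum>b\<in>Basis. (?z \<bullet> b) *\<^sub>R (A y b - A y0 b))"
      using linear_basis_expansion[OF lin[OF that(1)], of ?z]
        linear_basis_expansion[OF lin[OF y0], of ?z]
      by (simp add: sum_subtractf scaleR_diff_right)
    also have "norm \<dots> \<le> (\<Sum>b\<in>Basis. norm ?z * norm (A y b - A y0 b))"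
      by (rule sum_norm_le) (auto intro!: mult_right_mono Basis_le_norm)
    also have "\<dots> \<le> norm ?z * (m / 2)"
      unfolding sum_distrib_left[symmetric]
      using small by (intro mult_left_mono) auto
    finally have "norm (A y ?z - A y0 ?z) \<le> norm ?z * (m / 2)" .
    moreover have "norm (A y0 ?z) \<le> norm (A y ?z) + norm (A y ?z - A y0 ?z)"
      by (metis norm_minus_commute norm_triangle_sub)
    moreover have "A y ?z = v - A y w"
      using AB[OF that(1)] by (simp add: linear_diff[OF lin[OF that(1)]])
    ultimately have "m * norm ?z \<le> 2 * norm (v - A y w)"
      using m[of ?z] by (simp add: mult.commute)
    then show ?thesis
      using \<open>m > 0\<close> by (simp add: field_simps)
  qed
  have "((\<lambda>y. 2 / m * norm (v - A y w)) \<longlongrightarrow> 2 / m * norm (v - A y0 w)) (at y0 within W)"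
    by (intro tendsto_intros lim)
  then have "((\<lambda>y. 2 / m * norm (v - A y w)) \<longlongrightarrow> 0) (at y0 within W)"
    using AB[OF y0] by (simp add: w_def)
  moreover have "eventually (\<lambda>y. norm (B y v - w) \<le> 2 / m * norm (v - A y w)) (at y0 within W)"
    using ev eventually_at_filter[of "\<lambda>y. y \<in> W"] bound
    by (auto simp: eventually_at_filter elim!: eventually_mono)
  ultimately have "((\<lambda>y. B y v - w) \<longlongrightarrow> 0) (at y0 within W)"
    by (rule Lim_null_comparison[rotated])
  then show "((\<lambda>y. B y v) \<longlongrightarrow> B y0 v) (at y0 within W)"
    unfolding w_def by (rule LIM_zero_cancel)
qed

text \<open>
  With \<open>w = B y v\<close> for a fixed \<open>y\<close>, the identity \<open>B x v = w - B x (A x w - v)\<close> holds for all \<open>x\<close>, and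
  \<open>A x w - v\<close> vanishes at \<open>x = y\<close>. So the derivative exists at \<open>y\<close> and is the familiar
  \<open>- B (D A) B v\<close>, which involves only \<open>B\<close> and the first derivatives of \<open>A\<close>; this drives an
  induction on the order of differentiability.
\<close>

lemma times_cont_diff_on_inverse_operators:
  fixes A B :: "'m::euclidean_space \<Rightarrow> 'n::euclidean_space \<Rightarrow> 'n"
  assumes "open W"
    and linA: "\<And>y. y \<in> W \<Longrightarrow> linear (A y)" and linB: "\<And>y. y \<in> W \<Longrightarrow> linear (B y)"
    and BA: "\<And>y z. y \<in> W \<Longrightarrow> B y (A y z) = z"
    and AB: "\<And>y z. y \<in> W \<Longrightarrow> A y (B y z) = z"
    and "\<And>z. times_cont_diff_on k W (\<lambda>y. A y z)"
  shows "times_cont_diff_on k W (\<lambda>y. B y v)"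
  using assms(6)
proof (induction k arbitrary: v)
  case 0
  then show ?case
    by (simp, intro continuous_on_inverse_operators[where A = A and B = B] linA BA AB) auto
next
  case (Suc k)
  let ?D = "\<lambda>y z d. frechet_derivative (\<lambda>y. A y z) (at y) d"
  have lower: "times_cont_diff_on k W (\<lambda>y. A y z)" for z
    using Suc.prems by (rule times_cont_diff_on_SucD)
  have IH: "times_cont_diff_on k W (\<lambda>y. B y v)" for v
    by (rule Suc.IH[OF lower])
  have contB: "isCont (\<lambda>y. B y v) y" if "y \<in> W" for v y
    using times_cont_diff_on_mono[OF IH, of 0] that \<open>open W\<close> continuous_on_eq_continuous_at by auto
  have derivA: "((\<lambda>y. A y z) has_derivative ?D y z) (at y)" if "y \<in> W" for z y
    using has_derivative_frechet[OF Suc.prems that] .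
  \<comment> \<open>Linearity in the argument \<open>z\<close> of the family, not in the direction \<open>d\<close>: differentiation in \<open>y\<close> preserves it.\<close>
  have linD: "linear (\<lambda>z. ?D y z d)" if "y \<in> W" for y d
  proof (rule linearI)
    fix z z' and r :: real
    have "((\<lambda>y. A y (z + z')) has_derivative (\<lambda>d. ?D y z d + ?D y z' d)) (at y)"
      by (rule has_derivative_transform_within_open
          [OF has_derivative_add[OF derivA[OF that] derivA[OF that]] \<open>open W\<close> that])
         (simp add: linear_add[OF linA])
    from frechet_derivative_at[OF this] show "?D y (z + z') d = ?D y z d + ?D y z' d"
      by (metis)
    have "((\<lambda>y. A y (r *\<^sub>R z)) has_derivative (\<lambda>d. r *\<^sub>R ?D y z d)) (at y)"
      by (rule has_derivative_transform_within_open
          [OF has_derivative_scaleR_right[OF derivA[OF that]] \<open>open W\<close> that])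
         (simp add: linear_cmul[OF linA])
    from frechet_derivative_at[OF this] show "?D y (r *\<^sub>R z) d = r *\<^sub>R ?D y z d"
      by (metis)
  qed
  show ?case
  proof (rule times_cont_diff_on_derivI[OF _ _ \<open>open W\<close>])
    fix y assume y: "y \<in> W"
    let ?w = "B y v"
    have "((\<lambda>x. \<Sum>b\<in>Basis. ((A x ?w - v) \<bullet> b) *\<^sub>R B x b) has_derivative
            (\<lambda>d. \<Sum>b\<in>Basis. (?D y ?w d \<bullet> b) *\<^sub>R B y b)) (at y)"
    proof (intro has_derivative_sum has_derivative_zero_scaleR contB y)
      show "((\<lambda>x. (A x ?w - v) \<bullet> b) has_derivative (\<lambda>d. ?D y ?w d \<bullet> b)) (at y)" for b
        using derivA[OF y, of ?w] by (auto intro!: derivative_eq_intros)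
    qed (simp add: AB[OF y])
    moreover have "(\<Sum>b\<in>Basis. (?D y ?w d \<bullet> b) *\<^sub>R B y b) = B y (?D y ?w d)" for d
      by (rule linear_basis_expansion[OF linB[OF y], symmetric])
    ultimately have "((\<lambda>x. ?w - (\<Sum>b\<in>Basis. ((A x ?w - v) \<bullet> b) *\<^sub>R B x b)) has_derivative
            (\<lambda>d. - B y (?D y ?w d))) (at y)"
      using has_derivative_diff[OF has_derivative_const] by fastforce
    then show "((\<lambda>x. B x v) has_derivative (\<lambda>d. - B y (?D y (B y v) d))) (at y)"
    proof (rule has_derivative_transform_within_open[OF _ \<open>open W\<close> y])
      fix x assume x: "x \<in> W"
      have "(\<Sum>b\<in>Basis. ((A x ?w - v) \<bullet> b) *\<^sub>R B x b) = B x (A x ?w - v)"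
        by (rule linear_basis_expansion[OF linB[OF x], symmetric])
      also have "\<dots> = ?w - B x v"
        using BA[OF x] by (simp add: linear_diff[OF linB[OF x]])
      finally show "?w - (\<Sum>b\<in>Basis. ((A x ?w - v) \<bullet> b) *\<^sub>R B x b) = B x v" by simp
    qed
  next
    show "times_cont_diff_on k W (\<lambda>y. - B y (?D y (B y v) d))" for d
    proof -
      have "times_cont_diff_on k W (\<lambda>y. ?D y (B y v) d)"
        by (rule times_cont_diff_on_apply_linear[where F = "\<lambda>y z. ?D y z d", OF \<open>open W\<close> linD
              times_cont_diff_on_frechet[OF Suc.prems] IH])
      then have "times_cont_diff_on k W (\<lambda>y. B y (?D y (B y v) d))"
        by (intro times_cont_diff_on_apply_linear[where F = B, OF \<open>open W\<close> linB IH])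
      then show ?thesis
        by (rule times_cont_diff_on_bounded_linear[OF \<open>open W\<close>
              bounded_linear_minus[OF bounded_linear_ident]])
    qed
  qed
qed

text \<open>
  The derivative of \<open>H\<close> is pointwise the inverse of the derivative of \<open>h\<close> along \<open>H\<close>, so each order of
  smoothness of \<open>H\<close> yields the next one as long as \<open>h\<close> allows it.
\<close>

lemma times_cont_diff_on_inverse:
  fixes h H :: "'m::euclidean_space \<Rightarrow> 'm"
  assumes "open V" and "open W" and h: "times_cont_diff_on k V h" and "H ` W \<subseteq> V"
    and H: "\<And>y. y \<in> W \<Longrightarrow> (H has_derivative inv (frechet_derivative h (at (H y)))) (at y)"
    and bij: "\<And>y. y \<in> W \<Longrightarrow> bij (frechet_derivative h (at (H y)))"
  shows "times_cont_diff_on k W H"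
  using h
proof (induction k)
  case 0
  show ?case
    using H by (auto intro!: continuous_at_imp_continuous_on has_derivative_continuous)
next
  case (Suc k)
  have IH: "times_cont_diff_on k W H"
    using Suc.IH times_cont_diff_on_SucD[OF Suc.prems] .
  show ?case
  proof (rule times_cont_diff_on_derivI[OF H _ \<open>open W\<close>])
    let ?A = "\<lambda>y. frechet_derivative h (at (H y))"
    show "times_cont_diff_on k W (\<lambda>y. inv (?A y) v)" for v
    proof (rule times_cont_diff_on_inverse_operators[where A = ?A, OF \<open>open W\<close>])
      show "linear (?A y)" if "y \<in> W" for y
        using has_derivative_frechet[OF Suc.prems] \<open>H ` W \<subseteq> V\<close> that
        by (blast intro: has_derivative_linear)
      show "linear (inv (?A y))" if "y \<in> W" for y
        using H[OF that] by (rule has_derivative_linear)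
      show "inv (?A y) (?A y z) = z" "?A y (inv (?A y) z) = z" if "y \<in> W" for y z
        using bij[OF that] by (simp_all add: bij_is_inj bij_is_surj surj_f_inv_f)
      show "times_cont_diff_on k W (\<lambda>y. ?A y z)" for z
        using times_cont_diff_on_compose[OF assms(1,2) times_cont_diff_on_frechet[OF Suc.prems] IH
            \<open>H ` W \<subseteq> V\<close>] .
    qed
  qed
qed

section \<open>Inverse functions between convex bodies\<close>

text \<open>
  A \<open>C\<^sup>1\<close>-map with invertible derivative has a differentiable local inverse, whose derivative is the
  pointwise inverse; this formula raises the inverse to the full smoothness class of \<open>h\<close>.
\<close>

lemma local_inverse_times_cont_diff:
  fixes h :: "'m::euclidean_space \<Rightarrow> 'm"
  assumes "open V" and "p \<in> V" and "1 \<le> r"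
    and h: "\<And>k. enat k \<le> r \<Longrightarrow> times_cont_diff_on k V h"
    and inj: "inj (frechet_derivative h (at p))"
  obtains P Q H where "open P" "p \<in> P" "P \<subseteq> V" "open Q" "homeomorphism P Q h H"
    "\<And>k. enat k \<le> r \<Longrightarrow> times_cont_diff_on k Q H"
proof -
  let ?D = "\<lambda>x. frechet_derivative h (at x)"
  have h1: "times_cont_diff_on (Suc 0) V h"
    using h[of 1] \<open>1 \<le> r\<close> by (simp add: one_enat_def)
  have deriv: "(h has_derivative ?D x) (at x)" if "x \<in> V" for x
    using has_derivative_frechet[OF h1 that] .
  define h' where "h' x = Blinfun (?D x)" for x
  have h': "blinfun_apply (h' x) = ?D x" if "x \<in> V" for x
    unfolding h'_def by (rule bounded_linear_Blinfun_apply[OF has_derivative_bounded_linear[OF deriv[OF that]]])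
  have "continuous_on V h'"
  proof (rule continuous_on_blinfun_componentwise)
    show "continuous_on V (\<lambda>x. blinfun_apply (h' x) b)" for b
      using times_cont_diff_on_frechet[OF h1, of b] by (simp add: h' cong: continuous_on_cong)
  qed
  obtain g where "linear g" and g: "g \<circ> ?D p = id"
    using linear_injective_left_inverse[OF has_derivative_linear[OF deriv[OF \<open>p \<in> V\<close>]] inj] by blast
  have "Blinfun g o\<^sub>L h' p = id_blinfun"
  proof (rule blinfun_eqI)
    fix v
    have "g (?D p v) = v"
      using g by (metis comp_apply id_apply)
    then show "blinfun_apply (Blinfun g o\<^sub>L h' p) v = blinfun_apply id_blinfun v"
      using \<open>linear g\<close> h'[OF \<open>p \<in> V\<close>]
      by (simp add: bounded_linear_Blinfun_apply linear_conv_bounded_linear)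
  qed
  with \<open>open V\<close> deriv \<open>p \<in> V\<close> \<open>continuous_on V h'\<close> obtain P Q H H' where
    P: "open P" "P \<subseteq> V" "p \<in> P" "open Q" "h p \<in> Q" and hom: "homeomorphism P Q h H"
    and H: "\<And>y. y \<in> Q \<Longrightarrow> (H has_derivative H' y) (at y)"
      "\<And>y. y \<in> Q \<Longrightarrow> H' y = inv (blinfun_apply (h' (H y)))"
      "\<And>y. y \<in> Q \<Longrightarrow> bij (blinfun_apply (h' (H y)))"
    using inverse_function_theorem[of V h h' p "Blinfun g"] h' by (metis (no_types, lifting))
  have HV: "H ` Q \<subseteq> V"
    using homeomorphism_image2[OF hom] P by blast
  have "times_cont_diff_on k Q H" if "enat k \<le> r" for k
  proof (rule times_cont_diff_on_inverse[OF \<open>open V\<close> \<open>open Q\<close> h[OF that] HV])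
    show "(H has_derivative inv (?D (H y))) (at y)" and "bij (?D (H y))" if "y \<in> Q" for y
      using H[OF that] h'[of "H y"] HV that by auto
  qed
  with that P hom show thesis by blast
qed

text \<open>
  The inverse function theorem for manifolds with boundary, in local form: the local inverse cannot leave
  \<open>M\<close> because it would have to cross the frontier of \<open>M\<close>, which \<open>h\<close> sends to the frontier of
  \<open>N\<close>. Convexity of \<open>N\<close> makes the interior part of a small ball connected; convexity of \<open>M\<close> and \<open>N\<close> with
  nonempty interior makes each the closure of its interior.
\<close>

lemma local_diffeomorphism_of_convex_bodies:
  fixes h :: "'m::euclidean_space \<Rightarrow> 'm"
  assumes "open V" and "p \<in> V" and "1 \<le> r"
    and h: "\<And>k. enat k \<le> r \<Longrightarrow> times_cont_diff_on k V h"
    and inj: "inj (frechet_derivative h (at p))"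
    and M: "closed M" "convex M" "interior M \<noteq> {}" "p \<in> M"
    and N: "closed N" "convex N" "interior N \<noteq> {}"
    and hMN: "h ` (V \<inter> M) \<subseteq> N" and hfr: "h ` (V \<inter> frontier M) \<subseteq> frontier N"
  obtains P Q H where "open P" "p \<in> P" "P \<subseteq> V" "open Q" "homeomorphism P Q h H"
    "h ` (P \<inter> M) = Q \<inter> N"
    "\<And>k. enat k \<le> r \<Longrightarrow> times_cont_diff_on k Q H"
proof -
  obtain P\<^sub>0 Q\<^sub>0 H where P\<^sub>0: "open P\<^sub>0" "p \<in> P\<^sub>0" "P\<^sub>0 \<subseteq> V" "open Q\<^sub>0" and hom\<^sub>0: "homeomorphism P\<^sub>0 Q\<^sub>0 h H"
    and H: "\<And>k. enat k \<le> r \<Longrightarrow> times_cont_diff_on k Q\<^sub>0 H"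
    using local_inverse_times_cont_diff[OF assms(1-5)] by blast
  have "h p \<in> Q\<^sub>0"
    using hom\<^sub>0 \<open>p \<in> P\<^sub>0\<close> by (auto simp: homeomorphism_def)
  then obtain e where "e > 0" and e: "ball (h p) e \<subseteq> Q\<^sub>0"
    using \<open>open Q\<^sub>0\<close> open_contains_ball by blast
  \<comment> \<open>A ball, so that its intersection with the convex set \<open>interior N\<close> is connected.\<close>
  define Q where "Q = ball (h p) e"
  define P where "P = H ` Q"
  have Q: "open Q" "convex Q" "h p \<in> Q" "Q \<subseteq> Q\<^sub>0"
    using e \<open>e > 0\<close> by (auto simp: Q_def)
  have hom: "homeomorphism P Q h H"
    using homeomorphism_of_subsets[OF homeomorphism_symD[OF hom\<^sub>0] \<open>Q \<subseteq> Q\<^sub>0\<close> empty_subsetI P_def[symmetric]]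
    by (rule homeomorphism_symD)
  have open_image: "open (h ` U)" if "open U" "U \<subseteq> P\<^sub>0" for U
  proof -
    have "openin (top_of_set P\<^sub>0) U"
      using that \<open>open P\<^sub>0\<close> by (simp add: openin_open_eq)
    then have "openin (top_of_set Q\<^sub>0) (h ` U)"
      by (rule homeomorphism_imp_open_map[OF hom\<^sub>0])
    then show ?thesis
      using \<open>open Q\<^sub>0\<close> by (simp add: openin_open_eq)
  qed
  have "openin (top_of_set Q\<^sub>0) Q"
    using Q \<open>open Q\<^sub>0\<close> by (simp add: openin_open_eq)
  then have "openin (top_of_set P\<^sub>0) P"
    unfolding P_def by (rule homeomorphism_imp_open_map[OF homeomorphism_symD[OF hom\<^sub>0]])
  then have P: "open P" "P \<subseteq> P\<^sub>0"
    using \<open>open P\<^sub>0\<close> by (simp_all add: openin_open_eq)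
  have "p \<in> P"
    using Q(3) homeomorphism_apply1[OF hom\<^sub>0 \<open>p \<in> P\<^sub>0\<close>] unfolding P_def by force
  have "P \<subseteq> V"
    using P P\<^sub>0 by blast
  have clM: "closure (interior M) = M" and clN: "closure (interior N) = N"
    using M N by (simp_all add: convex_closure_interior)
  \<comment> \<open>An open subset of \<open>N\<close> lies in the interior of \<open>N\<close>.\<close>
  have interior_image: "h ` (P \<inter> interior M) \<subseteq> interior N"
  proof (rule interior_maximal)
    show "h ` (P \<inter> interior M) \<subseteq> N"
      using hMN \<open>P \<subseteq> V\<close> interior_subset[of M] by blast
    show "open (h ` (P \<inter> interior M))"
      using P by (intro open_image) auto
  qed
  have "p \<in> closure (interior M)"
    using clM \<open>p \<in> M\<close> by simp
  then obtain q where q: "q \<in> P" "q \<in> interior M"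
    using \<open>open P\<close> \<open>p \<in> P\<close> by (metis disjoint_iff open_Int_closure_eq_empty)
  have "connected (H ` (Q \<inter> interior N))"
    using homeomorphism_cont2[OF hom] \<open>convex Q\<close> \<open>convex N\<close>
    by (intro connected_continuous_image convex_connected convex_Int convex_interior)
       (auto intro: continuous_on_subset)
  moreover have "H ` (Q \<inter> interior N) \<inter> frontier M = {}"
  proof -
    have False if "y \<in> Q" "y \<in> interior N" "H y \<in> frontier M" for y
    proof -
      have "H y \<in> V"
        using homeomorphism_image2[OF hom] \<open>y \<in> Q\<close> \<open>P \<subseteq> V\<close> by blast
      then have "h (H y) \<in> frontier N"
        using hfr that by blast
      then show False
        using homeomorphism_apply2[OF hom \<open>y \<in> Q\<close>] that by (simp add: frontier_def)
    qed
    then show ?thesis by blast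
  qed
  moreover have "q \<in> H ` (Q \<inter> interior N) \<inter> M"
  proof -
    have "h q \<in> Q \<inter> interior N"
      using q interior_image homeomorphism_image1[OF hom] by blast
    then show ?thesis
      using homeomorphism_apply1[OF hom q(1)] q(2) interior_subset[of M] by force
  qed
  ultimately have sub: "H ` (Q \<inter> interior N) \<subseteq> M"
    using connected_Int_frontier[of "H ` (Q \<inter> interior N)" M] by blast
  \<comment> \<open>Frontier points of \<open>N\<close> are limits of interior ones, and \<open>M\<close> is closed.\<close>
  have "H y \<in> M" if y: "y \<in> Q" "y \<in> N" for y
  proof -
    have "Q \<inter> N \<subseteq> closure (Q \<inter> interior N)"
      using open_Int_closure_subset[OF \<open>open Q\<close>, of "interior N"] clN by simp
    then have "y \<in> closure (Q \<inter> interior N)"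
      using y by blast
    then obtain s where s: "\<And>n. s n \<in> Q \<inter> interior N" "s \<longlonglongrightarrow> y"
      by (auto simp: closure_sequential)
    have "isCont H y"
      using homeomorphism_cont2[OF hom] \<open>open Q\<close> y(1) by (simp add: continuous_on_eq_continuous_at)
    then have "(\<lambda>n. H (s n)) \<longlonglongrightarrow> H y"
      using s(2) isCont_tendsto_compose by blast
    then show ?thesis
      using closed_sequentially[OF \<open>closed M\<close>, of "\<lambda>n. H (s n)"] s(1) sub by blast
  qed
  then have "h ` (P \<inter> M) = Q \<inter> N"
    using hom hMN \<open>P \<subseteq> V\<close> unfolding homeomorphism_def by (fastforce simp: image_iff)
  moreover have "times_cont_diff_on k Q H" if "enat k \<le> r" for k
    using times_cont_diff_on_subset[OF H[OF that] Q(4)] .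
  ultimately show thesis
    using that P \<open>p \<in> P\<close> \<open>P \<subseteq> V\<close> Q hom by blast
qed

section \<open>Local homeomorphisms of compact spaces\<close>

lemma Hausdorff_space_separate_finite:
  assumes "Hausdorff_space X" and "finite F" and "F \<subseteq> topspace X"
  obtains D where "\<And>x. x \<in> F \<Longrightarrow> openin X (D x) \<and> x \<in> D x"
    and "\<And>x z. x \<in> F \<Longrightarrow> z \<in> F \<Longrightarrow> x \<noteq> z \<Longrightarrow> disjnt (D x) (D z)"
proof -
  have "\<exists>D. (\<forall>x\<in>F. openin X (D x) \<and> x \<in> D x) \<and>
            (\<forall>x\<in>F. \<forall>z\<in>F. x \<noteq> z \<longrightarrow> disjnt (D x) (D z))"
    using assms(2,3)
  proof (induction F rule: finite_induct)
    case empty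
    then show ?case by simp
  next
    case (insert a F)
    then obtain D where D: "\<forall>x\<in>F. openin X (D x) \<and> x \<in> D x"
      "\<forall>x\<in>F. \<forall>z\<in>F. x \<noteq> z \<longrightarrow> disjnt (D x) (D z)"
      by auto
    have "\<forall>z\<in>F. \<exists>A B. openin X A \<and> openin X B \<and> a \<in> A \<and> z \<in> B \<and> disjnt A B"
      using assms(1) insert.prems insert.hyps(2) unfolding Hausdorff_space_def
      by (metis insert_subset subsetD)
    then obtain A B where AB: "\<And>z. z \<in> F \<Longrightarrow> openin X (A z) \<and> openin X (B z) \<and> a \<in> A z \<and> z \<in> B z \<and> disjnt (A z) (B z)"
      by metis
    define A' where "A' = topspace X \<inter> \<Inter>(A ` F)"
    have "openin X A'"
      unfolding A'_def using AB insert.hyps(1)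
      by (cases "F = {}") (auto intro!: openin_Int openin_Inter)
    moreover have "a \<in> A'"
      using AB insert.prems by (auto simp: A'_def)
    moreover have "disjnt A' (B z)" if "z \<in> F" for z
      using AB[OF that] that by (auto simp: A'_def disjnt_iff)
    ultimately have A': "openin X A'" "a \<in> A'" "\<And>z. z \<in> F \<Longrightarrow> disjnt A' (B z)"
      by blast+
    define D' where "D' x = (if x = a then A' else D x \<inter> B x)" for x
    have "openin X (D' x) \<and> x \<in> D' x" if "x \<in> insert a F" for x
      using that A' D(1) AB by (auto simp: D'_def openin_Int)
    moreover have "disjnt (D' x) (D' z)" if xz: "x \<in> insert a F" "z \<in> insert a F" "x \<noteq> z" for x z
    proof -
      consider "x = a" "z \<in> F" | "z = a" "x \<in> F" | "x \<in> F" "z \<in> F" "x \<noteq> a" "z \<noteq> a"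
        using xz by blast
      then show ?thesis
      proof cases
        case 1
        then show ?thesis using A'(3)[of z] \<open>x \<noteq> z\<close> by (auto simp: D'_def disjnt_iff)
      next
        case 2
        then show ?thesis using A'(3)[of x] \<open>x \<noteq> z\<close> by (auto simp: D'_def disjnt_iff)
      next
        case 3
        then have "disjnt (D x) (D z)"
          using D(2) \<open>x \<noteq> z\<close> by blast
        with 3 show ?thesis by (auto simp: D'_def disjnt_iff)
      qed
    qed
    ultimately show ?case by blast
  qed
  then obtain D where D: "(\<forall>x\<in>F. openin X (D x) \<and> x \<in> D x) \<and>
      (\<forall>x\<in>F. \<forall>z\<in>F. x \<noteq> z \<longrightarrow> disjnt (D x) (D z))" ..
  show thesis
    by (rule that[of D]) (use D in simp_all)
qed

lemma connected_components_of_open_partition: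
  assumes "\<And>U. U \<in> \<U> \<Longrightarrow> openin X U \<and> connectedin X U" and "\<Union>\<U> = topspace X"
    and "pairwise disjnt \<U>"
  shows "connected_components_of X \<subseteq> \<U>"
proof
  fix C assume C: "C \<in> connected_components_of X"
  then obtain x where "x \<in> C" "x \<in> topspace X"
    using nonempty_connected_components_of connected_components_of_subset by blast
  then obtain U where U: "U \<in> \<U>" "x \<in> U"
    using assms(2) by blast
  have "topspace X - U = \<Union>(\<U> - {U})"
    using assms(2,3) U(1) by (auto simp: pairwise_def disjnt_iff)
  then have "closedin X U"
    using assms(1,2) U(1) unfolding closedin_def by (metis DiffD1 Sup_upper openin_Union)
  then have "C \<subseteq> U"
    using connectedin_clopen_cases[OF connectedin_connected_components_of[OF C]] assms(1) U \<open>x \<in> C\<close>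
    by (auto simp: disjnt_iff)
  moreover have "U \<subseteq> C"
    using connected_components_of_maximal[OF C] assms(1) U \<open>x \<in> C\<close> by (auto simp: disjnt_iff)
  ultimately show "C \<in> \<U>"
    using U(1) by auto
qed

text \<open>
  The fibre is compact, and neighbourhoods on which \<open>f\<close> is injective meet it in a single point each.
\<close>

lemma finite_fibre:
  assumes "compact_space X" and "t1_space Y" and "continuous_map X Y f"
    and loc_inj: "\<And>x. x \<in> topspace X \<Longrightarrow> \<exists>U. openin X U \<and> x \<in> U \<and> inj_on f U"
    and "y \<in> topspace Y"
  shows "finite {x \<in> topspace X. f x = y}"
proof -
  let ?F = "{x \<in> topspace X. f x = y}"
  have "closedin X {x \<in> topspace X. f x \<in> {y}}"
    using assms by (intro closedin_continuous_map_preimage) (auto simp: t1_space_closedin_singleton)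
  then have "compactin X ?F"
    using closedin_compact_space[OF \<open>compact_space X\<close>] by simp
  moreover obtain U where U: "\<And>x. x \<in> topspace X \<Longrightarrow> openin X (U x) \<and> x \<in> U x \<and> inj_on f (U x)"
    using loc_inj by metis
  ultimately obtain \<F> where \<F>: "finite \<F>" "\<F> \<subseteq> U ` ?F" "?F \<subseteq> \<Union>\<F>"
    unfolding compactin_def by (smt (verit, best) UN_I image_iff mem_Collect_eq subsetI)
  have "finite (?F \<inter> A)" if A: "A \<in> \<F>" for A
  proof -
    obtain x where "A = U x" "x \<in> ?F"
      using A \<F>(2) by blast
    then have "?F \<inter> A \<subseteq> {x}"
      using U[of x] by (auto dest: inj_onD)
    then show ?thesis
      by (rule finite_subset) simp
  qed
  then have "finite (\<Union>A\<in>\<F>. ?F \<inter> A)"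
    using \<open>finite \<F>\<close> by blast
  then show ?thesis
    by (rule rev_finite_subset) (use \<F> in blast)
qed

text \<open>
  The sheets are the parts above \<open>V\<close> of disjoint neighbourhoods of the fibre points: they are open, and
  connected because \<open>f\<close> maps each of them homeomorphically onto the connected set \<open>V\<close>. If the fibre
  is empty there are none, and \<open>V\<close> avoids the closed image of \<open>f\<close>.
\<close>

lemma local_homeomorphism_evenly_covers:
  assumes "compact_space X" and "Hausdorff_space X" and "Hausdorff_space Y"
    and "locally_connected_space Y"
    and f: "continuous_map X Y f" "open_map X Y f"
    and loc_inj: "\<And>x. x \<in> topspace X \<Longrightarrow> \<exists>U. openin X U \<and> x \<in> U \<and> inj_on f U"
    and y: "y \<in> topspace Y"
  obtains V where "openin Y V" and "y \<in> V"
    and "\<And>C. C \<in> sheets X f V \<Longrightarrow>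
           openin X C \<and> homeomorphic_map (subtopology X C) (subtopology Y V) f"
proof -
  let ?F = "{x \<in> topspace X. f x = y}"
  have "finite ?F"
    using finite_fibre[OF assms(1) _ f(1) loc_inj y] \<open>Hausdorff_space Y\<close> by (simp add: Hausdorff_imp_t1_space)
  obtain D where D: "\<And>x. x \<in> ?F \<Longrightarrow> openin X (D x) \<and> x \<in> D x"
    and D_disj: "\<And>x z. x \<in> ?F \<Longrightarrow> z \<in> ?F \<Longrightarrow> x \<noteq> z \<Longrightarrow> disjnt (D x) (D z)"
    using Hausdorff_space_separate_finite[OF \<open>Hausdorff_space X\<close> \<open>finite ?F\<close>] by blast
  obtain I where I: "\<And>x. x \<in> topspace X \<Longrightarrow> openin X (I x) \<and> x \<in> I x \<and> inj_on f (I x)"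
    using loc_inj by metis
  define U where "U x = D x \<inter> I x" for x
  have U: "openin X (U x)" "x \<in> U x" "inj_on f (U x)" if "x \<in> ?F" for x
    using D[OF that] I[of x] that by (auto simp: U_def inj_on_Int openin_Int)
  define K where "K = topspace X - (\<Union>x\<in>?F. U x)"
  have "closedin X K"
    unfolding K_def using U by (intro closedin_diff) auto
  then have "closedin Y (f ` K)"
    using continuous_imp_closed_map_gen[OF assms(1) Hausdorff_imp_kc_space[OF assms(3)] f(1)]
    by (simp add: closed_map_def)
  \<comment> \<open>Intersecting with \<open>topspace Y\<close> matters only for an empty fibre, where the indexed intersection is \<open>UNIV\<close>.\<close>
  define W where "W = (topspace Y \<inter> (\<Inter>x\<in>?F. f ` U x)) - f ` K"
  have "openin Y (topspace Y \<inter> (\<Inter>x\<in>?F. f ` U x))"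
  proof (cases "?F = {}")
    case True
    show ?thesis
      unfolding True by simp
  next
    case False
    have "openin Y (f ` U x)" if "x \<in> ?F" for x
      using U(1)[OF that] f(2) by (simp add: open_map_def)
    then have "openin Y (\<Inter>x\<in>?F. f ` U x)"
      using \<open>finite ?F\<close> False by (intro openin_Inter) blast+
    then show ?thesis
      by blast
  qed
  then have "openin Y W"
    unfolding W_def using \<open>closedin Y (f ` K)\<close> by (rule openin_diff)
  moreover have "y \<in> W"
    using y U(2) by (auto simp: W_def K_def)
  ultimately obtain V where V: "openin Y V" "connectedin Y V" "y \<in> V" "V \<subseteq> W"
    using \<open>locally_connected_space Y\<close> unfolding locally_connected_space by meson
  let ?P = "{x \<in> topspace X. f x \<in> V}"
  have "openin X ?P"
    using openin_continuous_map_preimage[OF f(1) V(1)] .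
  define C where "C x = U x \<inter> ?P" for x
  have C_open: "openin X (C x)" if "x \<in> ?F" for x
    unfolding C_def using U[OF that] \<open>openin X ?P\<close> by blast
  have C_hom: "homeomorphic_map (subtopology X (C x)) (subtopology Y V) f" if x: "x \<in> ?F" for x
  proof (rule bijective_open_imp_homeomorphic_map)
    have "f ` C x = V"
    proof
      show "V \<subseteq> f ` C x"
      proof
        fix v assume "v \<in> V"
        then have "v \<in> f ` U x"
          using V(4) x by (auto simp: W_def)
        then show "v \<in> f ` C x"
          using \<open>v \<in> V\<close> openin_subset[OF U(1)[OF x]] by (auto simp: C_def)
      qed
    qed (auto simp: C_def)
    then show "f ` topspace (subtopology X (C x)) = topspace (subtopology Y V)"
      using openin_subset[OF C_open[OF x]] openin_subset[OF V(1)]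
      by (simp add: Int_absorb1)
    show "continuous_map (subtopology X (C x)) (subtopology Y V) f"
      using f(1) by (auto simp: continuous_map_in_subtopology C_def continuous_map_from_subtopology)
    show "open_map (subtopology X (C x)) (subtopology Y V) f"
      using f(2) C_open[OF x] V(1) \<open>f ` C x = V\<close> unfolding open_map_def
      by (metis image_mono openin_open_subtopology)
    show "inj_on f (topspace (subtopology X (C x)))"
      using U(3)[OF x] by (auto simp: C_def intro: inj_on_subset)
  qed
  have "sheets X f V \<subseteq> C ` ?F"
    unfolding sheets_def
  proof (rule connected_components_of_open_partition)
    show "openin (subtopology X ?P) A \<and> connectedin (subtopology X ?P) A" if A: "A \<in> C ` ?F" for A
    proof -
      obtain x where x: "x \<in> ?F" "A = C x"
        using A by blast
      have "connected_space (subtopology X (C x))"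
        using homeomorphic_map_imp_homeomorphic_space[OF C_hom[OF x(1)]] V(2)
        by (auto simp: connectedin_def homeomorphic_connected_space)
      then have "connectedin X (C x)"
        using openin_subset[OF C_open[OF x(1)]] by (simp add: connectedin_def)
      moreover have "C x \<subseteq> ?P"
        by (simp add: C_def)
      ultimately show ?thesis
        unfolding x(2) using C_open[OF x(1)] \<open>openin X ?P\<close>
        by (simp add: connectedin_subtopology openin_open_subtopology)
    qed
    show "\<Union>(C ` ?F) = topspace (subtopology X ?P)"
    proof
      show "topspace (subtopology X ?P) \<subseteq> \<Union>(C ` ?F)"
      proof
        fix z assume "z \<in> topspace (subtopology X ?P)"
        then have "z \<in> topspace X" "f z \<in> V"
          by auto
        then have "z \<notin> K"
          using V(4) by (auto simp: W_def)
        then show "z \<in> \<Union>(C ` ?F)"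
          using \<open>z \<in> topspace X\<close> \<open>f z \<in> V\<close> by (auto simp: K_def C_def)
      qed
    qed (auto simp: C_def)
    show "pairwise disjnt (C ` ?F)"
      using D_disj by (auto simp: pairwise_def C_def U_def disjnt_iff)
  qed
  then show thesis
    using that[OF V(1,3)] C_open C_hom by blast
qed

section \<open>Model spaces, charts and the boundary\<close>

lemma first_axis_in_Basis: "(first_axis :: 'm::euclidean_space) \<in> Basis"
  unfolding first_axis_def using nonempty_Basis by (simp add: some_in_eq)

text \<open>
  The two possible codomains of a chart. Apart from \<open>model_space_axis_step\<close>, they enter the argument
  only as closed convex sets with nonempty interior.
\<close>

definition model_space :: "'m::euclidean_space set \<Rightarrow> bool" where
  "model_space M \<longleftrightarrow> M = UNIV \<or> M = half_space"

lemma closed_model_space: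
  assumes "model_space M"
  shows "closed M"
proof -
  have "closed (half_space :: 'a set)"
    unfolding half_space_def by (rule closed_halfspace_component_ge)
  with assms show ?thesis
    by (auto simp: model_space_def)
qed

lemma convex_model_space:
  assumes "model_space M"
  shows "convex M"
proof -
  have "convex (half_space :: 'a set)"
    unfolding half_space_def using convex_halfspace_ge[of 0 first_axis] by (simp add: inner_commute)
  with assms show ?thesis
    by (auto simp: model_space_def)
qed

lemma interior_model_space_nonempty:
  fixes M :: "'m::euclidean_space set"
  assumes "model_space M"
  shows "interior M \<noteq> {}"
proof -
  have "(first_axis :: 'm) \<noteq> 0"
    using first_axis_in_Basis nonzero_Basis by blast
  then have "interior {x::'m. 0 \<le> first_axis \<bullet> x} = {x. 0 < first_axis \<bullet> x}"
    by (rule interior_halfspace_ge)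
  then have "first_axis \<in> interior (half_space :: 'm set)"
    using \<open>(first_axis :: 'm) \<noteq> 0\<close> by (simp add: half_space_def inner_commute)
  then show ?thesis
    using assms by (auto simp: model_space_def)
qed

text \<open>
  From every point of a model space one can move in all coordinate directions, which makes derivatives within it
  unique.
\<close>

lemma model_space_axis_step:
  fixes M :: "'m::euclidean_space set"
  assumes "model_space M" and "p \<in> M" and "b \<in> Basis" and "0 \<le> t"
  shows "p + t *\<^sub>R b \<in> M"
proof -
  have "0 \<le> t * (b \<bullet> first_axis)"
    using assms(3,4) first_axis_in_Basis[where 'm='m] by (simp add: inner_Basis)
  with assms show ?thesis
    by (auto simp: model_space_def half_space_def inner_add_left)
qed

text \<open>
  A chart together with its model space; naming the model avoids a case distinction between interior
  and boundary charts.
\<close>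

definition chart_onto :: "'a topology \<Rightarrow> 'a set \<Rightarrow> ('a \<Rightarrow> 'm::euclidean_space) \<Rightarrow> 'm set \<Rightarrow> bool" where
  "chart_onto X U \<phi> M \<longleftrightarrow>
     openin X U \<and> model_space M \<and> homeomorphic_map (subtopology X U) (top_of_set M) \<phi>"

lemma is_chart_chart_onto:
  "is_chart X (U, \<phi>) \<longleftrightarrow> (\<exists>M. chart_onto X U \<phi> M)"
proof -
  have "(\<exists>M. chart_onto X U \<phi> M) \<longleftrightarrow> chart_onto X U \<phi> UNIV \<or> chart_onto X U \<phi> half_space"
    unfolding chart_onto_def model_space_def by blast
  then show ?thesis
    by (simp add: is_chart_def chart_onto_def model_space_def) blast
qed

lemma chart_onto_bij:
  assumes "chart_onto X U \<phi> M"
  shows "U \<subseteq> topspace X" and "\<phi> ` U = M" and "inj_on \<phi> U"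
proof -
  have h: "homeomorphic_map (subtopology X U) (top_of_set M) \<phi>" and "openin X U"
    using assms by (auto simp: chart_onto_def)
  then show sub: "U \<subseteq> topspace X"
    by (simp add: openin_subset)
  show "\<phi> ` U = M" "inj_on \<phi> U"
    using homeomorphic_imp_surjective_map[OF h] homeomorphic_imp_injective_map[OF h] sub
    by (simp_all add: Int_absorb1)
qed

lemma chart_onto_open_image:
  assumes "chart_onto X U \<phi> M" and "openin X A" and "A \<subseteq> U"
  obtains B where "open B" and "\<phi> ` A = M \<inter> B"
proof -
  have "openin (subtopology X U) A"
    using assms by (simp add: chart_onto_def openin_open_subtopology)
  then have "openin (top_of_set M) (\<phi> ` A)"
    using assms(1) homeomorphic_imp_open_map unfolding chart_onto_def open_map_def by blast
  then show thesis
    using that by (auto simp: openin_open)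
qed

lemma chart_onto_open_preimage:
  assumes "chart_onto X U \<phi> M" and "open B"
  shows "openin X {x \<in> U. \<phi> x \<in> B}"
proof -
  have "continuous_map (subtopology X U) euclidean \<phi>"
    using assms(1) homeomorphic_imp_continuous_map unfolding chart_onto_def
    by (blast dest: continuous_map_into_fulltopology)
  then have "openin (subtopology X U) {x \<in> topspace (subtopology X U). \<phi> x \<in> B}"
    using \<open>open B\<close> by (intro openin_continuous_map_preimage) auto
  moreover have "topspace (subtopology X U) = U"
    using chart_onto_bij(1)[OF assms(1)] by (simp add: Int_absorb1)
  ultimately have "openin (subtopology X U) {x \<in> U. \<phi> x \<in> B}"
    by metis
  then show ?thesis
    using assms(1) by (simp add: chart_onto_def openin_open_subtopology)
qed

lemma chart_onto_restrict:
  assumes "chart_onto X U \<phi> M" and "A \<subseteq> U"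
  shows "homeomorphic_map (subtopology X A) (top_of_set (\<phi> ` A)) \<phi>"
proof -
  have "\<phi> ` (topspace (subtopology X U) \<inter> A) = topspace (top_of_set M) \<inter> \<phi> ` A"
    using chart_onto_bij[OF assms(1)] assms(2) by (simp add: Int_absorb1 Int_absorb2) blast
  then have "homeomorphic_map (subtopology (subtopology X U) A) (subtopology (top_of_set M) (\<phi> ` A)) \<phi>"
    using assms(1) unfolding chart_onto_def by (blast intro: homeomorphic_map_subtopologies)
  moreover have "\<phi> ` A \<subseteq> M"
    using chart_onto_bij[OF assms(1)] assms(2) by blast
  ultimately show ?thesis
    using assms(2) by (simp add: subtopology_subtopology Int_absorb1)
qed

lemma top_of_set_homeomorphic_space:
  "top_of_set S homeomorphic_space top_of_set T \<longleftrightarrow> S homeomorphic T"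
proof -
  have "homeomorphic_maps (top_of_set S) (top_of_set T) g h \<longleftrightarrow> homeomorphism S T g h" for g h
    unfolding homeomorphic_maps_def homeomorphism_def continuous_map_in_subtopology
    by (auto simp: image_subset_iff image_iff Pi_iff) metis+
  then show ?thesis
    by (simp add: homeomorphic_space_def homeomorphic_def)
qed

text \<open>
  A ball inside the model is homeomorphic to the whole space. Conversely, a neighbourhood of \<open>x\<close> homeomorphic to
  Euclidean space has, by invariance of domain, an image under the chart that is open in the whole
  space, which therefore lies in the interior of the model.
\<close>

lemma boundary_in_chart:
  fixes \<phi> :: "'a \<Rightarrow> 'm::euclidean_space"
  assumes c: "chart_onto X U \<phi> M" and "x \<in> U"
  shows "x \<in> manifold_boundary TYPE('m) X \<longleftrightarrow> \<phi> x \<in> frontier M"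
proof -
  have "\<phi> x \<in> M" "x \<in> topspace X"
    using chart_onto_bij[OF c] \<open>x \<in> U\<close> by auto
  have "(\<exists>A. openin X A \<and> x \<in> A \<and> subtopology X A homeomorphic_space (euclidean :: 'm topology))
        \<longleftrightarrow> \<phi> x \<in> interior M"
  proof
    assume "\<phi> x \<in> interior M"
    then obtain e where "e > 0" and e: "ball (\<phi> x) e \<subseteq> M"
      by (auto simp: mem_interior)
    define A where "A = {z \<in> U. \<phi> z \<in> ball (\<phi> x) e}"
    have A: "openin X A" "A \<subseteq> U" "x \<in> A"
      using chart_onto_open_preimage[OF c open_ball] \<open>e > 0\<close> \<open>x \<in> U\<close> by (auto simp: A_def)
    have "\<phi> ` A = ball (\<phi> x) e"
      using e chart_onto_bij(2)[OF c] unfolding A_def by blast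
    then have "subtopology X A homeomorphic_space top_of_set (ball (\<phi> x) e)"
      using chart_onto_restrict[OF c A(2)] homeomorphic_map_imp_homeomorphic_space by metis
    also have "top_of_set (ball (\<phi> x) e) homeomorphic_space (euclidean :: 'm topology)"
      using homeomorphic_ball_UNIV[OF \<open>e > 0\<close>, of "\<phi> x"]
        top_of_set_homeomorphic_space[of "ball (\<phi> x) e" "UNIV :: 'm set"] by simp
    finally show "\<exists>A. openin X A \<and> x \<in> A \<and> subtopology X A homeomorphic_space (euclidean :: 'm topology)"
      using A by blast
  next
    assume "\<exists>A. openin X A \<and> x \<in> A \<and> subtopology X A homeomorphic_space (euclidean :: 'm topology)"
    then obtain A k where A: "openin X A" "x \<in> A"
      and k: "homeomorphic_map (subtopology X A) (euclidean :: 'm topology) k"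
      by (auto simp: homeomorphic_space)
    define B where "B = U \<inter> A"
    have "openin X B" "B \<subseteq> A" "B \<subseteq> U" "x \<in> B"
      using A c \<open>x \<in> U\<close> by (auto simp: B_def chart_onto_def)
    then have "openin (subtopology X A) B"
      by (simp add: A(1) openin_open_subtopology)
    then have "open (k ` B)"
      using homeomorphic_imp_open_map[OF k] by (simp add: open_map_def)
    have "A \<subseteq> topspace X"
      by (rule openin_subset[OF A(1)])
    have "homeomorphic_map (subtopology (subtopology X A) B) (subtopology euclidean (k ` B)) k"
      by (rule homeomorphic_map_subtopologies[OF k])
         (use \<open>A \<subseteq> topspace X\<close> \<open>B \<subseteq> A\<close> in \<open>auto simp: Int_absorb1\<close>)
    then have "homeomorphic_map (subtopology X B) (top_of_set (k ` B)) k"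
      using \<open>B \<subseteq> A\<close> by (simp add: subtopology_subtopology Int_absorb1)
    then have "top_of_set (k ` B) homeomorphic_space subtopology X B"
      using homeomorphic_map_imp_homeomorphic_space homeomorphic_space_sym by metis
    also have "subtopology X B homeomorphic_space top_of_set (\<phi> ` B)"
      using chart_onto_restrict[OF c \<open>B \<subseteq> U\<close>] by (rule homeomorphic_map_imp_homeomorphic_space)
    finally have "k ` B homeomorphic \<phi> ` B"
      by (simp add: top_of_set_homeomorphic_space)
    then obtain g h where gh: "homeomorphism (k ` B) (\<phi> ` B) g h"
      by (auto simp: homeomorphic_def)
    have "open (g ` k ` B)"
      using invariance_of_domain[OF homeomorphism_cont1[OF gh] \<open>open (k ` B)\<close>]
        homeomorphism_apply1[OF gh] by (metis inj_on_inverseI)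
    then have "open (\<phi> ` B)"
      using homeomorphism_image1[OF gh] by simp
    then show "\<phi> x \<in> interior M"
      using \<open>x \<in> B\<close> \<open>B \<subseteq> U\<close> chart_onto_bij(2)[OF c] by (intro interiorI[of "\<phi> ` B"]) auto
  qed
  then show ?thesis
    using \<open>\<phi> x \<in> M\<close> \<open>x \<in> topspace X\<close> closure_subset[of M]
    by (auto simp: manifold_boundary_def frontier_def)
qed

lemma locally_connected_space_charts:
  fixes \<A> :: "('a, 'm::euclidean_space) chart set"
  assumes "\<And>c. c \<in> \<A> \<Longrightarrow> is_chart X c" and "(\<Union>c\<in>\<A>. fst c) = topspace X"
  shows "locally_connected_space X"
  unfolding locally_connected_space
proof (intro allI impI, elim conjE)
  fix A x assume "openin X A" "x \<in> A"
  then have "x \<in> topspace X"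
    using openin_subset by blast
  then obtain c where "c \<in> \<A>" "x \<in> fst c"
    unfolding assms(2)[symmetric] by blast
  then obtain U and \<phi> :: "'a \<Rightarrow> 'm" where "c = (U, \<phi>)" "is_chart X (U, \<phi>)" "x \<in> U"
    using assms(1)[of c] by (cases c) auto
  then obtain M where c: "chart_onto X U \<phi> M"
    unfolding is_chart_chart_onto by blast
  then have "openin X (U \<inter> A)"
    using \<open>openin X A\<close> by (auto simp: chart_onto_def)
  then obtain B where "open B" and B: "\<phi> ` (U \<inter> A) = M \<inter> B"
    using chart_onto_open_image[OF c] by (metis inf_le1)
  have "\<phi> x \<in> B"
    using B \<open>x \<in> U\<close> \<open>x \<in> A\<close> by blast
  then obtain e where "e > 0" and e: "ball (\<phi> x) e \<subseteq> B"
    using \<open>open B\<close> open_contains_ball by blast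
  define V where "V = {z \<in> U. \<phi> z \<in> ball (\<phi> x) e}"
  have V: "openin X V" "x \<in> V" "V \<subseteq> U"
    using chart_onto_open_preimage[OF c open_ball] \<open>e > 0\<close> \<open>x \<in> U\<close> by (auto simp: V_def)
  have "\<phi> ` V = M \<inter> ball (\<phi> x) e"
    using chart_onto_bij(2)[OF c] unfolding V_def by blast
  then have "connected (\<phi> ` V)"
    using convex_Int[OF convex_model_space[of M] convex_ball[of "\<phi> x" e]] c
    by (simp add: chart_onto_def convex_connected)
  then have "connected_space (subtopology X V)"
    using homeomorphic_connected_space[OF
        homeomorphic_map_imp_homeomorphic_space[OF chart_onto_restrict[OF c \<open>V \<subseteq> U\<close>]]]
    by (metis connectedin_def connectedin_iff_connected)
  then have "connectedin X V"
    using openin_subset[OF V(1)] by (simp add: connectedin_def)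
  moreover have "V \<subseteq> A"
  proof
    fix z assume "z \<in> V"
    then have "\<phi> z \<in> \<phi> ` (U \<inter> A)" "z \<in> U"
      using B e \<open>\<phi> ` V = _\<close> V(3) by blast+
    then show "z \<in> A"
      using chart_onto_bij(3)[OF c] by (auto dest: inj_onD)
  qed
  ultimately show "\<exists>V. openin X V \<and> connectedin X V \<and> x \<in> V \<and> V \<subseteq> A"
    using V by blast
qed


section \<open>Local inverses in charts\<close>

text \<open>
  The local diffeomorphism theorem for convex bodies, carried over to the manifolds by a pair of charts.
  The neighbourhood \<open>N\<close> can be taken inside any prescribed \<open>N\<^sub>0\<close>; applied to a whole sheet \<open>N\<^sub>0\<close>, this
  identifies \<open>H\<close> with the inverse of \<open>f\<close> on that particular sheet.
\<close>

lemma chart_local_inverse: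
  fixes \<phi> :: "'a \<Rightarrow> 'm::euclidean_space" and \<psi> :: "'b \<Rightarrow> 'm"
  assumes "1 \<le> r" and c: "chart_onto X U \<phi> M" and d: "chart_onto Y W \<psi> M'"
    and f: "continuous_map X Y f"
    and smooth: "Cr_smooth_on r (coord_dom (U, \<phi>) (W, \<psi>) f (topspace X)) (coord_rep (U, \<phi>) (W, \<psi>) f)"
    and x: "x \<in> U" "f x \<in> W"
    and L: "(coord_rep (U, \<phi>) (W, \<psi>) f has_derivative L)
              (at (\<phi> x) within coord_dom (U, \<phi>) (W, \<psi>) f (topspace X))" "dim (range L) = DIM('m)"
    and boundary: "f ` manifold_boundary TYPE('m) X \<subseteq> manifold_boundary TYPE('m) Y"
    and N\<^sub>0: "openin X N\<^sub>0" "x \<in> N\<^sub>0"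
  obtains N Q H where "openin X N" "x \<in> N" "N \<subseteq> N\<^sub>0" "openin Y (f ` N)" "f ` N \<subseteq> W"
    "inj_on f N" "open Q" "\<psi> ` f ` N = Q \<inter> M'" "\<And>z. z \<in> N \<Longrightarrow> H (\<psi> (f z)) = \<phi> z"
    "\<And>k. enat k \<le> r \<Longrightarrow> times_cont_diff_on k Q H"
proof -
  define g where "g = coord_rep (U, \<phi>) (W, \<psi>) f"
  define A where "A = coord_dom (U, \<phi>) (W, \<psi>) f (topspace X)"
  define p where "p = \<phi> x"
  have M: "model_space M" "model_space M'"
    using c d by (simp_all add: chart_onto_def)
  note cb = chart_onto_bij[OF c] and db = chart_onto_bij[OF d]
  define N\<^sub>1 where "N\<^sub>1 = U \<inter> {z \<in> topspace X. f z \<in> W}"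
  have "openin X N\<^sub>1"
    unfolding N\<^sub>1_def using c d openin_continuous_map_preimage[OF f] by (auto simp: chart_onto_def)
  then have "openin X (N\<^sub>0 \<inter> N\<^sub>1)"
    using N\<^sub>0 by blast
  have "N\<^sub>1 \<subseteq> U"
    by (auto simp: N\<^sub>1_def)
  have xN\<^sub>1: "x \<in> N\<^sub>1"
    using x cb(1) by (auto simp: N\<^sub>1_def)
  have A: "A = \<phi> ` N\<^sub>1"
    by (auto simp: A_def coord_dom_def N\<^sub>1_def)
  obtain O\<^sub>1 where O\<^sub>1: "open O\<^sub>1" "\<phi> ` N\<^sub>1 = M \<inter> O\<^sub>1"
    using chart_onto_open_image[OF c \<open>openin X N\<^sub>1\<close> \<open>N\<^sub>1 \<subseteq> U\<close>] by metis
  obtain O\<^sub>2 where O\<^sub>2: "open O\<^sub>2" "\<phi> ` (N\<^sub>0 \<inter> N\<^sub>1) = M \<inter> O\<^sub>2"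
    using chart_onto_open_image[OF c \<open>openin X (N\<^sub>0 \<inter> N\<^sub>1)\<close>] \<open>N\<^sub>1 \<subseteq> U\<close> by (metis le_infI2)
  have g: "g (\<phi> z) = \<psi> (f z)" if "z \<in> U" for z
    using inv_into_f_f[OF cb(3) that] by (simp add: g_def coord_rep_def)
  have pA: "p \<in> A"
    using xN\<^sub>1 by (auto simp: A p_def)
  have "Cr_smooth_on r A g"
    using smooth by (simp add: A_def g_def)
  from bspec[OF this[unfolded Cr_smooth_on_def] pA] obtain V\<^sub>0 h where
    ext: "open V\<^sub>0 \<and> p \<in> V\<^sub>0 \<and> (\<forall>k. enat k \<le> r \<longrightarrow> times_cont_diff_on k V\<^sub>0 h) \<and> (\<forall>y\<in>V\<^sub>0 \<inter> A. h y = g y)"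
    by (elim exE) (rule that)
  then have V\<^sub>0: "open V\<^sub>0" "p \<in> V\<^sub>0" and h: "\<And>k. enat k \<le> r \<Longrightarrow> times_cont_diff_on k V\<^sub>0 h"
    and hg: "\<And>y. y \<in> V\<^sub>0 \<inter> A \<Longrightarrow> h y = g y"
    by simp_all
  \<comment> \<open>On \<open>V \<inter> M\<close> the extension \<open>h\<close> represents \<open>f\<close>, at points of \<open>N\<^sub>0\<close>.\<close>
  define V where "V = V\<^sub>0 \<inter> O\<^sub>2"
  have "p \<in> M \<inter> O\<^sub>2"
    unfolding O\<^sub>2(2)[symmetric] p_def using xN\<^sub>1 N\<^sub>0 by blast
  then have V: "open V" "p \<in> V" "p \<in> M"
    using V\<^sub>0 O\<^sub>2(1) by (auto simp: V_def)
  have hV: "times_cont_diff_on k V h" if "enat k \<le> r" for k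
    using times_cont_diff_on_subset[OF h[OF that]] by (simp add: V_def)
  have V_points: "\<exists>z \<in> N\<^sub>0 \<inter> N\<^sub>1. q = \<phi> z \<and> h q = \<psi> (f z)" if q: "q \<in> V" "q \<in> M" for q
  proof -
    have "q \<in> M \<inter> O\<^sub>2"
      using q by (simp add: V_def)
    then obtain z where z: "z \<in> N\<^sub>0 \<inter> N\<^sub>1" "q = \<phi> z"
      unfolding O\<^sub>2(2)[symmetric] by blast
    then have "q \<in> V\<^sub>0 \<inter> A"
      using q by (auto simp: V_def A)
    then show ?thesis
      using hg[of q] g[of z] z \<open>N\<^sub>1 \<subseteq> U\<close> by auto
  qed
  let ?D = "frechet_derivative h (at p)"
  have "times_cont_diff_on (Suc 0) V\<^sub>0 h"
    using h[of 1] \<open>1 \<le> r\<close> by (simp add: one_enat_def)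
  then have D: "(h has_derivative ?D) (at p)"
    using V\<^sub>0(2) by (rule has_derivative_frechet)
  \<comment> \<open>Near \<open>p\<close> and within \<open>A\<close>, the extension \<open>h\<close> agrees with \<open>g\<close>, and derivatives within \<open>A\<close> are unique.\<close>
  have "?D = L"
  proof (rule frechet_derivative_unique_within)
    obtain e\<^sub>0 where e\<^sub>0: "e\<^sub>0 > 0" "ball p e\<^sub>0 \<subseteq> V\<^sub>0"
      using V\<^sub>0 open_contains_ball by blast
    show "(g has_derivative ?D) (at p within A)"
    proof (rule has_derivative_transform_within[OF has_derivative_at_withinI[OF D] e\<^sub>0(1) pA])
      fix q assume q: "q \<in> A" "dist q p < e\<^sub>0"
      then have "q \<in> V\<^sub>0"
        using e\<^sub>0(2) by (auto simp: dist_commute)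
      with q(1) show "h q = g q"
        by (intro hg) blast
    qed
    show "(g has_derivative L) (at p within A)"
      using L(1) by (simp add: g_def A_def p_def)
  next
    fix b :: 'm and e :: real
    assume b: "b \<in> Basis" and "e > 0"
    have "p \<in> O\<^sub>1"
      using pA A O\<^sub>1(2) by blast
    then obtain e\<^sub>1 where e\<^sub>1: "e\<^sub>1 > 0" "ball p e\<^sub>1 \<subseteq> O\<^sub>1"
      using O\<^sub>1(1) open_contains_ball by blast
    define t where "t = min e e\<^sub>1 / 2"
    have t: "0 < t" "t < e" "t < e\<^sub>1"
      using \<open>e > 0\<close> e\<^sub>1(1) by (auto simp: t_def)
    have "p + t *\<^sub>R b \<in> M"
      using model_space_axis_step[OF M(1) V(3) b] t by simp
    moreover have "p + t *\<^sub>R b \<in> ball p e\<^sub>1"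
      using t b by (simp add: dist_norm)
    ultimately have "p + t *\<^sub>R b \<in> A"
      using e\<^sub>1(2) A O\<^sub>1(2) by blast
    then show "\<exists>t. 0 < \<bar>t\<bar> \<and> \<bar>t\<bar> < e \<and> p + t *\<^sub>R b \<in> A"
      using t by (intro exI[of _ t]) auto
  qed
  moreover have "inj L"
  proof -
    have lin: "linear L"
      using L(1) by (rule has_derivative_linear)
    have "span (range L) = UNIV"
      using L(2) dim_eq_full by blast
    moreover have "span (range L) = range L"
      by (simp add: lin linear_subspace_image span_eq_iff)
    ultimately show ?thesis
      using lin linear_surjective_imp_injective by blast
  qed
  ultimately have inj: "inj ?D"
    by simp
  have hM: "h ` (V \<inter> M) \<subseteq> M'"
    using V_points db(2) by (fastforce simp: N\<^sub>1_def)
  have "closed M"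
    using M closed_model_space by blast
  have hfr: "h ` (V \<inter> frontier M) \<subseteq> frontier M'"
  proof
    fix y assume "y \<in> h ` (V \<inter> frontier M)"
    then obtain q where q: "q \<in> V" "q \<in> frontier M" "y = h q"
      by blast
    then have "q \<in> M"
      using frontier_subset_closed[OF \<open>closed M\<close>] by blast
    then obtain z where z: "z \<in> N\<^sub>1" "q = \<phi> z" "y = \<psi> (f z)"
      using V_points q by blast
    then have "z \<in> manifold_boundary TYPE('m) X"
      using boundary_in_chart[OF c] q(2) \<open>N\<^sub>1 \<subseteq> U\<close> by blast
    then have "f z \<in> manifold_boundary TYPE('m) Y"
      using boundary by blast
    then show "y \<in> frontier M'"
      using boundary_in_chart[OF d] z by (auto simp: N\<^sub>1_def)
  qed
  obtain P Q H where P: "open P" "p \<in> P" "P \<subseteq> V" and "open Q" and hom: "homeomorphism P Q h H"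
    and PQ: "h ` (P \<inter> M) = Q \<inter> M'"
    and H: "\<And>k. enat k \<le> r \<Longrightarrow> times_cont_diff_on k Q H"
    using local_diffeomorphism_of_convex_bodies[OF V(1,2) \<open>1 \<le> r\<close> hV inj \<open>closed M\<close>
        convex_model_space[OF M(1)] interior_model_space_nonempty[OF M(1)] V(3)
        closed_model_space[OF M(2)] convex_model_space[OF M(2)] interior_model_space_nonempty[OF M(2)]
        hM hfr] by blast
  define N where "N = {z \<in> U. \<phi> z \<in> P}"
  have N: "openin X N" "x \<in> N" "N \<subseteq> U"
    using chart_onto_open_preimage[OF c P(1)] P(2) x(1) by (auto simp: N_def p_def)
  have \<phi>N: "\<phi> ` N = P \<inter> M"
    using cb(2) unfolding N_def by blast
  have N_points: "z \<in> N\<^sub>0 \<and> z \<in> N\<^sub>1 \<and> h (\<phi> z) = \<psi> (f z)" if z: "z \<in> N" for z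
  proof -
    have "\<phi> z \<in> V" "\<phi> z \<in> M"
      using \<phi>N P(3) z by blast+
    then obtain z' where z': "z' \<in> N\<^sub>0 \<inter> N\<^sub>1" "\<phi> z = \<phi> z'" "h (\<phi> z) = \<psi> (f z')"
      using V_points by blast
    moreover have "z = z'"
      using inj_onD[OF cb(3) z'(2)] z z'(1) N(3) \<open>N\<^sub>1 \<subseteq> U\<close> by blast
    ultimately show ?thesis by blast
  qed
  have fN: "f ` N \<subseteq> W"
    using N_points by (auto simp: N\<^sub>1_def)
  have H_inv: "H (\<psi> (f z)) = \<phi> z" if "z \<in> N" for z
  proof -
    have "\<phi> z \<in> P"
      using that by (simp add: N_def)
    then show ?thesis
      using homeomorphism_apply1[OF hom] N_points[OF that] by metis
  qed
  have image: "\<psi> ` f ` N = Q \<inter> M'"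
  proof -
    have "\<psi> ` f ` N = h ` \<phi> ` N"
      using N_points by (simp add: image_image)
    then show ?thesis
      using PQ \<phi>N by simp
  qed
  have "f ` N = {w \<in> W. \<psi> w \<in> Q}"
  proof
    show "{w \<in> W. \<psi> w \<in> Q} \<subseteq> f ` N"
    proof clarify
      fix w assume w: "w \<in> W" "\<psi> w \<in> Q"
      then have "\<psi> w \<in> \<psi> ` f ` N"
        unfolding image using db(2) by blast
      then show "w \<in> f ` N"
        using inj_on_image_mem_iff[OF db(3) w(1) fN] by blast
    qed
  qed (use fN image in blast)
  then have "openin Y (f ` N)"
    using chart_onto_open_preimage[OF d \<open>open Q\<close>] by simp
  moreover have "inj_on f N"
    using H_inv cb(3) N(3) by (metis inj_on_def subsetD)
  moreover have "N \<subseteq> N\<^sub>0"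
    using N_points by blast
  ultimately show thesis
    using that[of N Q H] N fN image \<open>open Q\<close> H_inv H by blast
qed

lemma Cr_smooth_on_subset:
  assumes "Cr_smooth_on r B g" and "A \<subseteq> B"
  shows "Cr_smooth_on r A g"
  unfolding Cr_smooth_on_def
proof
  fix x assume "x \<in> A"
  with assms obtain V h where "open V \<and> x \<in> V \<and> (\<forall>k. enat k \<le> r \<longrightarrow> times_cont_diff_on k V h) \<and>
      (\<forall>y\<in>V \<inter> B. h y = g y)"
    unfolding Cr_smooth_on_def by (meson subsetD)
  then show "\<exists>V h. open V \<and> x \<in> V \<and> (\<forall>k. enat k \<le> r \<longrightarrow> times_cont_diff_on k V h) \<and>
      (\<forall>y\<in>V \<inter> A. h y = g y)"
    using \<open>A \<subseteq> B\<close> by (intro exI[of _ V] exI[of _ h]) auto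
qed

text \<open>
  The charts of all structures in the class together cover the space, because the class contains the
  structure that generates it.
\<close>

lemma Cr_manifold_atlas:
  fixes S :: "('a, 'm::euclidean_space) chart set set"
  assumes "Cr_manifold r X S"
  shows "Hausdorff_space X" and "\<And>c. c \<in> \<Union>S \<Longrightarrow> is_chart X c" and "(\<Union>c\<in>\<Union>S. fst c) = topspace X"
proof -
  show "Hausdorff_space X"
    using assms by (simp add: Cr_manifold_def topological_manifold_def)
  obtain \<A> where \<A>: "Cr_structure r X \<A>" and S: "S = Cr_equivalence r X `` {\<A>}"
    using assms unfolding Cr_manifold_def by (auto elim: quotientE)
  have structures: "Cr_structure r X \<B>" if "\<B> \<in> S" for \<B>
    using that by (simp add: S Cr_equivalence_def)
  then show chart: "is_chart X c" if "c \<in> \<Union>S" for c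
    using that unfolding Cr_structure_def by blast
  have "\<A> \<in> S"
    using \<A> by (simp add: S Cr_equivalence_def)
  show "(\<Union>c\<in>\<Union>S. fst c) = topspace X"
  proof
    show "(\<Union>c\<in>\<Union>S. fst c) \<subseteq> topspace X"
      using structures unfolding Cr_structure_def by blast
    show "topspace X \<subseteq> (\<Union>c\<in>\<Union>S. fst c)"
      using \<A> \<open>\<A> \<in> S\<close> unfolding Cr_structure_def by blast
  qed
qed

lemma local_inverse_in_charts:
  fixes S :: "('a, 'm::euclidean_space) chart set set" and T :: "('b, 'm) chart set set"
  assumes "1 \<le> r" and X: "Cr_manifold r X S" and Y: "Cr_manifold r Y T"
    and f: "Cr_mapping r X S Y T f" and nondegenerate: "nondegenerate_differential X S T f"
    and boundary: "f ` manifold_boundary TYPE('m) X \<subseteq> manifold_boundary TYPE('m) Y"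
    and c: "c \<in> \<Union>S" and d: "d \<in> \<Union>T" and x: "x \<in> fst c" "f x \<in> fst d"
    and N\<^sub>0: "openin X N\<^sub>0" "x \<in> N\<^sub>0"
  obtains N Q H where "openin X N" "x \<in> N" "N \<subseteq> N\<^sub>0" "openin Y (f ` N)" "f ` N \<subseteq> fst d"
    "inj_on f N" "open Q" "snd d ` f ` N = Q \<inter> snd d ` fst d" "inj_on (snd d) (fst d)"
    "\<And>z. z \<in> N \<Longrightarrow> H (snd d (f z)) = snd c z"
    "\<And>k. enat k \<le> r \<Longrightarrow> times_cont_diff_on k Q H"
proof -
  obtain M where M: "chart_onto X (fst c) (snd c) M"
    using Cr_manifold_atlas(2)[OF X c] is_chart_chart_onto[of X "fst c" "snd c"] by auto
  obtain M' where M': "chart_onto Y (fst d) (snd d) M'"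
    using Cr_manifold_atlas(2)[OF Y d] is_chart_chart_onto[of Y "fst d" "snd d"] by auto
  have cont: "continuous_map X Y f"
    using f by (simp add: Cr_mapping_def Cr_mapping_on_def)
  have smooth: "Cr_smooth_on r (coord_dom c d f (topspace X)) (coord_rep c d f)"
    using f c d unfolding Cr_mapping_def Cr_mapping_on_def by blast
  have "x \<in> topspace X"
    using N\<^sub>0 openin_subset by blast
  then obtain L where L: "(coord_rep c d f has_derivative L)
      (at (snd c x) within coord_dom c d f (topspace X))" "dim (range L) = DIM('m)"
    using nondegenerate c d x unfolding nondegenerate_differential_def by blast
  show thesis
  proof (rule chart_local_inverse[OF \<open>1 \<le> r\<close> M M' cont _ x _ L(2) boundary N\<^sub>0])
    fix N Q H
    assume "openin X N" "x \<in> N" "N \<subseteq> N\<^sub>0" "openin Y (f ` N)" "f ` N \<subseteq> fst d"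
      "inj_on f N" "open Q" "snd d ` f ` N = Q \<inter> M'" "\<And>z. z \<in> N \<Longrightarrow> H (snd d (f z)) = snd c z"
      "\<And>k. enat k \<le> r \<Longrightarrow> times_cont_diff_on k Q H"
    then show thesis
      using chart_onto_bij[OF M'] by (intro that[of N Q H]) simp_all
  qed (use smooth L(1) in simp_all)
qed

section \<open>The covering\<close>

theorem theorem2p1:
  fixes r :: enat
    and X :: "'a topology" and S :: "('a, 'm::euclidean_space) chart set set"
    and Y :: "'b topology" and T :: "('b, 'm) chart set set"
    and f :: "'a \<Rightarrow> 'b"
  assumes "1 \<le> r"
    and "Cr_manifold r X S" and "connected_space X" and "compact_space X"
    and "Cr_manifold r Y T" and "connected_space Y"
    and "Cr_mapping r X S Y T f"
    and "nondegenerate_differential X S T f"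
    and "f ` manifold_boundary TYPE('m) X \<subseteq> manifold_boundary TYPE('m) Y"
  shows "smooth_covering r X S Y T f"
proof -
  note atlasX = Cr_manifold_atlas[OF assms(2)] and atlasY = Cr_manifold_atlas[OF assms(5)]
  have f: "continuous_map X Y f"
    using assms(7) by (simp add: Cr_mapping_def Cr_mapping_on_def)
  have fY: "f x \<in> topspace Y" if "x \<in> topspace X" for x
    using f that by (auto simp: continuous_map_def)
  have smooth: "Cr_smooth_on r (coord_dom c d f (topspace X)) (coord_rep c d f)"
    if "c \<in> \<Union>S" "d \<in> \<Union>T" for c d
    using assms(7) that unfolding Cr_mapping_def Cr_mapping_on_def by blast
  note local_inverse = local_inverse_in_charts[OF assms(1,2,5,7,8,9)]
  have local_homeo: "\<exists>N. openin X N \<and> x \<in> N \<and> N \<subseteq> N\<^sub>0 \<and> openin Y (f ` N) \<and> inj_on f N"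
    if N\<^sub>0: "openin X N\<^sub>0" "x \<in> N\<^sub>0" for x N\<^sub>0
  proof -
    have "x \<in> topspace X"
      using N\<^sub>0 openin_subset by blast
    obtain c where c: "c \<in> \<Union>S" "x \<in> fst c"
      using \<open>x \<in> topspace X\<close> unfolding atlasX(3)[symmetric] by blast
    obtain d where d: "d \<in> \<Union>T" "f x \<in> fst d"
      using fY[OF \<open>x \<in> topspace X\<close>] unfolding atlasY(3)[symmetric] by blast
    obtain N where "openin X N" "x \<in> N" "N \<subseteq> N\<^sub>0" "openin Y (f ` N)" "inj_on f N"
      by (rule local_inverse[OF c(1) d(1) c(2) d(2) N\<^sub>0])
    then show ?thesis by blast
  qed
  have "open_map X Y f"
    unfolding open_map_def
  proof (intro allI impI)
    fix A assume A: "openin X A"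
    have "\<exists>B. openin Y B \<and> y \<in> B \<and> B \<subseteq> f ` A" if y: "y \<in> f ` A" for y
    proof -
      obtain x where x: "x \<in> A" "y = f x"
        using y by blast
      obtain N where N: "x \<in> N" "N \<subseteq> A" "openin Y (f ` N)"
        using local_homeo[OF A x(1)] by blast
      then show ?thesis
        unfolding x(2) by (intro exI[of _ "f ` N"]) blast
    qed
    then show "openin Y (f ` A)"
      using openin_subopen[of Y "f ` A"] by blast
  qed
  have loc_inj: "\<exists>N. openin X N \<and> x \<in> N \<and> inj_on f N" if "x \<in> topspace X" for x
    using local_homeo[OF openin_topspace that] by blast
  have "locally_connected_space Y"
    using locally_connected_space_charts[of "\<Union>T" Y] atlasY by blast
  have "\<exists>V. openin Y V \<and> y \<in> V \<and>
        (\<forall>C\<in>sheets X f V. homeomorphic_map (subtopology X C) (subtopology Y V) f \<and>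
                            Cr_diffeomorphism_on r X S C Y T V f)" if y: "y \<in> topspace Y" for y
  proof -
    obtain V where V: "openin Y V" "y \<in> V"
      and sheets: "\<And>C. C \<in> sheets X f V \<Longrightarrow>
           openin X C \<and> homeomorphic_map (subtopology X C) (subtopology Y V) f"
      using local_homeomorphism_evenly_covers[OF assms(4) atlasX(1) atlasY(1)
          \<open>locally_connected_space Y\<close> f \<open>open_map X Y f\<close> loc_inj y] by blast
    have "Cr_diffeomorphism_on r X S C Y T V f" if "C \<in> sheets X f V" for C
    proof -
      have C: "openin X C" and hom: "homeomorphic_map (subtopology X C) (subtopology Y V) f"
        using sheets[OF that] by auto
      have "C \<subseteq> topspace X" "V \<subseteq> topspace Y"
        using C V(1) by (simp_all add: openin_subset)
      then have bij: "bij_betw f C V"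
        using homeomorphic_imp_surjective_map[OF hom] homeomorphic_imp_injective_map[OF hom]
        by (simp add: bij_betw_def Int_absorb1)
      let ?g = "inv_into C f"
      have "Cr_mapping_on r X S C Y T V f"
        unfolding Cr_mapping_on_def
      proof (intro conjI ballI)
        show "continuous_map (subtopology X C) (subtopology Y V) f"
          using hom by (rule homeomorphic_imp_continuous_map)
        fix c d assume "c \<in> \<Union>S" "d \<in> \<Union>T"
        have "coord_dom c d f C \<subseteq> coord_dom c d f (topspace X)"
          using \<open>C \<subseteq> topspace X\<close> by (auto simp: coord_dom_def)
        then show "Cr_smooth_on r (coord_dom c d f C) (coord_rep c d f)"
          by (rule Cr_smooth_on_subset[OF smooth[OF \<open>c \<in> \<Union>S\<close> \<open>d \<in> \<Union>T\<close>]])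
      qed
      moreover have "Cr_mapping_on r Y T V X S C ?g"
        unfolding Cr_mapping_on_def
      proof (intro conjI ballI)
        obtain g' where g': "homeomorphic_maps (subtopology X C) (subtopology Y V) f g'"
          using hom by (auto simp: homeomorphic_map_maps)
        then have "continuous_map (subtopology Y V) (subtopology X C) g'"
          by (simp add: homeomorphic_maps_def)
        moreover have "g' v = ?g v" if "v \<in> topspace (subtopology Y V)" for v
        proof -
          have "g' v \<in> C" "f (g' v) = v"
            using g' that by (auto simp: homeomorphic_maps_def continuous_map_def)
          then show ?thesis
            using bij by (metis bij_betw_imp_inj_on inv_into_f_f)
        qed
        ultimately show "continuous_map (subtopology Y V) (subtopology X C) ?g"
          by (rule continuous_map_eq)
        fix d c assume d: "d \<in> \<Union>T" and c: "c \<in> \<Union>S"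
        show "Cr_smooth_on r (coord_dom d c ?g V) (coord_rep d c ?g)"
          unfolding Cr_smooth_on_def
        proof
          fix q assume "q \<in> coord_dom d c ?g V"
          then obtain w where w: "q = snd d w" "w \<in> fst d" "w \<in> V" "?g w \<in> fst c"
            by (auto simp: coord_dom_def)
          have g: "?g w \<in> C" "f (?g w) = w"
            using bij w(3) by (simp_all add: bij_betw_def inv_into_into f_inv_into_f)
          have fw: "f (?g w) \<in> fst d"
            using g(2) w(2) by simp
          \<comment> \<open>A neighbourhood inside the sheet \<open>C\<close>, on which \<open>f\<close> is injective, so \<open>H\<close> represents \<open>?g\<close>.\<close>
          obtain N Q H where N: "?g w \<in> N" "N \<subseteq> C" "f ` N \<subseteq> fst d" and Q: "open Q"
            and image: "snd d ` f ` N = Q \<inter> snd d ` fst d" and inj: "inj_on (snd d) (fst d)"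
            and H: "\<And>z. z \<in> N \<Longrightarrow> H (snd d (f z)) = snd c z"
            and H_smooth: "\<And>k. enat k \<le> r \<Longrightarrow> times_cont_diff_on k Q H"
            by (rule local_inverse[OF c d w(4) fw C g(1)]) (rule that)
          have "snd d (f (?g w)) \<in> snd d ` f ` N"
            using N(1) by blast
          then have "q \<in> Q"
            unfolding image using g(2) w(1) by simp
          moreover have "H s = coord_rep d c ?g s" if s: "s \<in> Q \<inter> coord_dom d c ?g V" for s
          proof -
            obtain v where v: "s = snd d v" "v \<in> fst d"
              using s by (auto simp: coord_dom_def)
            then have "snd d v \<in> snd d ` f ` N"
              using s unfolding image by blast
            then have "v \<in> f ` N"
              using inj_on_image_mem_iff[OF inj v(2) N(3)] by blast
            then obtain z where z: "z \<in> N" "v = f z"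
              by blast
            then have "?g v = z"
              using bij N(2) by (metis bij_betw_imp_inj_on inv_into_f_f subsetD)
            then show ?thesis
              using H[OF z(1)] v z(2) inj by (simp add: coord_rep_def)
          qed
          ultimately show "\<exists>V' h. open V' \<and> q \<in> V' \<and> (\<forall>k. enat k \<le> r \<longrightarrow> times_cont_diff_on k V' h) \<and>
              (\<forall>y\<in>V' \<inter> coord_dom d c ?g V. h y = coord_rep d c ?g y)"
            using Q H_smooth by (intro exI[of _ Q] exI[of _ H]) simp
        qed
      qed
      ultimately show ?thesis
        using C V(1) bij by (simp add: Cr_diffeomorphism_on_def)
    qed
    then show ?thesis
      using V sheets by blast
  qed
  then show ?thesis
    using assms(7) by (simp add: smooth_covering_def)
qed

end
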